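(* Let $\ell\in\mathbb{N}$ and let $G=([n],\mathcal{E})$ be a graph. Suppose the problem $$\text{(SDP)}\qquad \min\{\langle A_0,X\rangle:\ b_i^l\le\langle A_i,X\rangle\le b_i^u\ \ \forall i\in[m],\ X\in\mathbb{S}^n_+\}$$ has $(G,\ell)$-SPLR structure. (i) If (SDP) has an optimal solution, then it has an optimal solution $X$ such that $\mathrm{rank}(X)\le \mathrm{tw}(G)+\varphi(\ell)+1$. (ii) If $\mathrm{tw}(G)=\mathrm{pw}(G)$ and (SDP) has an optimal solution, then it has an optimal solution $X$ such that $\mathrm{rank}(X)\le \mathrm{tw}(G)+\ell+1$.
   Context: Notation. $\mathbb{N}=\{0,1,2,\dots\}$; $[n]=\{1,\dots,n\}$; $\mathbb{S}^n$ is the space of real symmetric $n\times n$ matrices with trace inner product $\langle\cdot,\cdot\rangle$, and $\mathbb{S}^n_+$ its positive semidefinite cone. Graphs are simple and undirected. For a graph $G=([n],\mathcal{E})$, $\mathbb{S}^n(\mathcal{E},0)=\{X\in\mathbb{S}^n: X_{ij}=X_{ji}=0 \text{ whenever } i\ne j,\ ij\notin\mathcal{E}\}$. SDP data. In (SDP), $A_i\in\mathbb{S}^n$ for $i\in\{0,1,\dots,m\}$ and $-\infty\le b_i^l\le b_i^u<+\infty$ for $i\in[m]$. SPLR structure. (SDP) has $(G,\ell)$-SPLR (sparse plus low-rank) structure if there exist decompositions $A_i=A_i^s+A_i^l$ with $A_i^s\in\mathbb{S}^n(\mathcal{E},0)$ for all $i\in\{0,\dots,m\}$ and $\mathrm{rank}([A_0^l,A_1^l,\dots,A_m^l])\le\ell$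 (column-wise concatenation). Tree-width $\mathrm{tw}(G)$ and path-width $\mathrm{pw}(G)$: a tree decomposition of $G=([n],\mathcal{E})$ is a pair $(T,\{V_t\}_{t\in T})$ with $T$ a tree and $V_t\subset[n]$ such that (a) $[n]=\bigcup_t V_t$; (b) every edge $ij\in\mathcal{E}$ has $i,j\in V_t$ for some $t$; (c) if $t_2$ lies on the path of $T$ from $t_1$ to $t_3$ then $V_{t_1}\cap V_{t_3}\subset V_{t_2}$. Its width is $\max_t|V_t|-1$; $\mathrm{tw}(G)$ is the minimum width over all tree decompositions, and $\mathrm{pw}(G)$ the minimum width over those with $T$ a path. The function $\varphi:\mathbb{N}\to\mathbb{N}$: $\varphi(0)=0$, and for $\ell\ge1$, $\varphi(\ell)$ is the smallest integer such that for any $U\in\mathbb{R}^{2\ell\times\ell}$ and $M\in\mathbb{S}^\ell$ the set $$\{Y\in\mathbb{S}^{2\ell}_+:\ U^\top YU=M,\ Y_{1:\ell,1:\ell}=I_\ell,\ Y_{\ell+1:2\ell,\ell+1:2\ell}=I_\ell\}$$ is either empty or contains an element of rank at most $\varphi(\ell)$. Here $Y_{a:b,c:d}$ is the submatrix with rows $a,\dots,b$ and columns $c,\dots,d$. *)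

theory Defs
  imports
    "HOL-Library.Extended_Real"
    "Jordan_Normal_Form.DL_Rank"
    "Jordan_Normal_Form.DL_Submatrix"
    "Graph_Theory.Pair_Digraph"
    "Graph_Theory.Vertex_Walk"
    "Graph_Theory.Digraph_Component"
begin

text \<open>
  Simple undirected graphs are \<open>pair_graph\<close>s (finite, loop-free, symmetric arc relation).
  Vertices, matrix indices and submatrix indices start at 0, so the index set
  \<open>1, \<dots>, n\<close> of the mathematical text is rendered as \<open>{0..<n}\<close>.
\<close>

definition sym_mats :: "nat \<Rightarrow> real mat set" where
  "sym_mats n = {X \<in> carrier_mat n n. transpose_mat X = X}"

definition psd_mats :: "nat \<Rightarrow> real mat set" where
  "psd_mats n = {X \<in> sym_mats n. \<forall>v \<in> carrier_vec n. 0 \<le> v \<bullet> (X *\<^sub>v v)}"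

definition mat_trace :: "real mat \<Rightarrow> real" where
  "mat_trace A = (\<Sum>i<dim_row A. A $$ (i, i))"

definition trace_inner :: "real mat \<Rightarrow> real mat \<Rightarrow> real" where
  "trace_inner A X = mat_trace (transpose_mat A * X)"

definition sparse_sym_mats :: "nat \<Rightarrow> nat pair_pre_digraph \<Rightarrow> real mat set" where
  "sparse_sym_mats n G =
     {X \<in> sym_mats n. \<forall>i<n. \<forall>j<n. i \<noteq> j \<and> (i, j) \<notin> parcs G \<longrightarrow> X $$ (i, j) = 0}"

text \<open>
  The library constant \<open>Digraph_Component.tree\<close> is not used: it forbids directed cycles, and
  in a symmetric digraph every edge already gives the directed cycle \<open>u, v, u\<close>. An undirected
  cycle is a path on at least three vertices whose end points are adjacent.
\<close>

definition undirected_tree :: "'a pair_pre_digraph \<Rightarrow> bool" where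
  "undirected_tree T \<longleftrightarrow> pair_graph T \<and> Digraph_Component.connected (with_proj T) \<and>
     \<not> (\<exists>p. vpath p (with_proj T) \<and> 3 \<le> length p \<and> (last p, hd p) \<in> parcs T)"

definition path_graph :: "'a pair_pre_digraph \<Rightarrow> bool" where
  "path_graph T \<longleftrightarrow> (\<exists>p. p \<noteq> [] \<and> distinct p \<and> pverts T = set p \<and>
     parcs T = set (vwalk_arcs p) \<union> (set (vwalk_arcs p))\<inverse>)"

definition tree_decomposition ::
    "'a pair_pre_digraph \<Rightarrow> 'b pair_pre_digraph \<Rightarrow> ('b \<Rightarrow> 'a set) \<Rightarrow> bool" where
  "tree_decomposition G T V \<longleftrightarrow> undirected_tree T \<and>
     (\<forall>t\<in>pverts T. V t \<subseteq> pverts G) \<and>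
     pverts G = (\<Union>t\<in>pverts T. V t) \<and>
     (\<forall>(i, j)\<in>parcs G. \<exists>t\<in>pverts T. i \<in> V t \<and> j \<in> V t) \<and>
     (\<forall>p. vpath p (with_proj T) \<longrightarrow> (\<forall>t\<in>set p. V (hd p) \<inter> V (last p) \<subseteq> V t))"

text \<open>
  Widths are integers because the graph without vertices has width \<open>-1\<close>.
\<close>

definition decomposition_width :: "'b pair_pre_digraph \<Rightarrow> ('b \<Rightarrow> 'a set) \<Rightarrow> int" where
  "decomposition_width T V = int (Max ((\<lambda>t. card (V t)) ` pverts T)) - 1"

text \<open>
  Decomposition trees are finite, so taking their nodes in \<open>nat\<close> is no restriction.
  The sets below are finite and nonempty for every finite graph: the width lies between \<open>-1\<close> and
  the number of vertices minus 1, and a single bag containing all vertices is a decomposition.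
\<close>

definition treewidth :: "'a pair_pre_digraph \<Rightarrow> int" where
  "treewidth G = Min {decomposition_width T V | (T :: nat pair_pre_digraph) V.
     tree_decomposition G T V}"

definition pathwidth :: "'a pair_pre_digraph \<Rightarrow> int" where
  "pathwidth G = Min {decomposition_width T V | (T :: nat pair_pre_digraph) V.
     tree_decomposition G T V \<and> path_graph T}"

text \<open>
  In \<open>phi\<close> the bound \<open>2 * l\<close> is always admissible and a negative bound never is
  (some \<open>phi_set l U M\<close> is nonempty when \<open>l \<ge> 1\<close>), so the smallest integer is a \<open>LEAST\<close> over \<open>nat\<close>.
\<close>

definition phi_set :: "nat \<Rightarrow> real mat \<Rightarrow> real mat \<Rightarrow> real mat set" where
  "phi_set l U M = {Y \<in> psd_mats (2 * l).
     transpose_mat U * Y * U = M \<and>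
     submatrix Y {0..<l} {0..<l} = 1\<^sub>m l \<and>
     submatrix Y {l..<2 * l} {l..<2 * l} = 1\<^sub>m l}"

definition phi :: "nat \<Rightarrow> nat" where
  "phi l = (if l = 0 then 0 else
     (LEAST k. \<forall>U \<in> carrier_mat (2 * l) l. \<forall>M \<in> sym_mats l.
        phi_set l U M = {} \<or> (\<exists>Y \<in> phi_set l U M. vec_space.rank (2 * l) Y \<le> k)))"

definition concat_mats :: "nat \<Rightarrow> nat \<Rightarrow> (nat \<Rightarrow> real mat) \<Rightarrow> real mat" where
  "concat_mats n m B = mat n ((m + 1) * n) (\<lambda>(i, j). B (j div n) $$ (i, j mod n))"

definition SPLR :: "nat \<Rightarrow> nat \<Rightarrow> nat pair_pre_digraph \<Rightarrow> nat \<Rightarrow> (nat \<Rightarrow> real mat) \<Rightarrow> bool" where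
  "SPLR n m G l A \<longleftrightarrow> (\<exists>As Al.
     (\<forall>i\<le>m. As i \<in> sparse_sym_mats n G \<and> Al i \<in> carrier_mat n n \<and> A i = As i + Al i) \<and>
     vec_space.rank n (concat_mats n m Al) \<le> l)"

text \<open>
  The bounds are extended reals; entries at indices outside \<open>{1..m}\<close> are irrelevant.
\<close>

definition sdp_feasible ::
    "nat \<Rightarrow> nat \<Rightarrow> (nat \<Rightarrow> real mat) \<Rightarrow> (nat \<Rightarrow> ereal) \<Rightarrow> (nat \<Rightarrow> ereal) \<Rightarrow> real mat set" where
  "sdp_feasible n m A bl bu = {X \<in> psd_mats n.
     \<forall>i\<in>{1..m}. bl i \<le> ereal (trace_inner (A i) X) \<and> ereal (trace_inner (A i) X) \<le> bu i}"

definition sdp_optimal ::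
    "nat \<Rightarrow> nat \<Rightarrow> (nat \<Rightarrow> real mat) \<Rightarrow> (nat \<Rightarrow> ereal) \<Rightarrow> (nat \<Rightarrow> ereal) \<Rightarrow> real mat set" where
  "sdp_optimal n m A bl bu = {X \<in> sdp_feasible n m A bl bu.
     \<forall>Y \<in> sdp_feasible n m A bl bu. trace_inner (A 0) X \<le> trace_inner (A 0) Y}"

end

theory Submission
  imports Defs "Jordan_Normal_Form.DL_Rank_Submatrix"
begin

text \<open>
  Write an optimal \<open>X\<close> as a Gram matrix of vectors \<open>x i\<close>. The low-rank parts of the data
  have the form \<open>a B a\<^sup>T\<close> with a common \<open>n \<times> l\<close> matrix \<open>a\<close>, so all values of the problem are
  determined by the inner products within the bags of a tree decomposition and by the Gram matrix of
  the \<open>l\<close> vectors \<open>y k = \<Sum>i. a i k * x i\<close>. It therefore suffices to replace the \<open>x i\<close> by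
  vectors in a space of small dimension with the same inner products.

  For a path decomposition of width \<open>w\<close>, sweep through the bags and carry the partial sums of the \<open>y k\<close> along: a bag together
  with the partial sums spans at most \<open>w + 1 + l\<close> dimensions, and realizations of consecutive bags are
  aligned by an isometry. For a tree, the partial sums of a leaf are merged into those of its parent.
  Undoing this merge requires two families of \<open>l\<close> vectors, orthogonal to the parent's bag, with
  prescribed Gram matrices and prescribed Gram matrix of their sum; in orthonormal coordinates this is
  the problem defining \<open>phi\<close>.
\<close>

section \<open>Gram matrices of vector families\<close>

text \<open>A Gram matrix determines its vectors up to an isometry. This is why realizations of
  different bags can be glued without extra dimensions: they only have to agree in the inner
  products of what they share. The sums \<open>y k\<close> run over all vertices and so couple bags
  that share nothing; carrying partial sums makes this coupling local. On a path one partial sum per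
  \<open>k\<close> is pending at a time, and passing to the next bag changes it only by a
  combination of vectors of that bag, hence \<open>l\<close> extra dimensions. In a tree several
  subtrees meet at a node, and keeping their partial sums apart would cost \<open>l\<close>
  dimensions each. Merging them loses information, since the Gram matrix of a sum does not determine
  those of the summands. Only the components orthogonal to the bag are affected, because those in
  its span are given by coefficients. So \<open>w\<close> coordinates, the width plus 1, are
  reserved for the bag and \<open>phi l\<close> for the two orthogonal families, and the dimension
  does not grow with the number of merges.\<close>

definition ip :: "nat \<Rightarrow> (nat \<Rightarrow> real) \<Rightarrow> (nat \<Rightarrow> real) \<Rightarrow> real" where
  "ip D u v = (\<Sum>k<D. u k * v k)"

definition lc :: "'i set \<Rightarrow> ('i \<Rightarrow> real) \<Rightarrow> ('i \<Rightarrow> nat \<Rightarrow> real) \<Rightarrow> nat \<Rightarrow> real" where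
  "lc I a u = (\<lambda>k. \<Sum>i\<in>I. a i * u i k)"

text \<open>Vectors are functions whose coordinates from the stated dimension on are ignored, so one
  type serves every dimension and the two families may live in spaces of different
  dimension.\<close>

definition gram_eq ::
    "'i set \<Rightarrow> nat \<Rightarrow> ('i \<Rightarrow> nat \<Rightarrow> real) \<Rightarrow> nat \<Rightarrow> ('i \<Rightarrow> nat \<Rightarrow> real) \<Rightarrow> bool" where
  "gram_eq I D u N v \<longleftrightarrow> (\<forall>i\<in>I. \<forall>j\<in>I. ip D (u i) (u j) = ip N (v i) (v j))"

lemma ip_commute: "ip D u v = ip D v u"
  by (simp add: ip_def mult.commute)

lemma ip_add_left: "ip D (\<lambda>k. u k + v k) w = ip D u w + ip D v w"
  by (simp add: ip_def sum.distrib distrib_right)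

lemma ip_scale_left: "ip D (\<lambda>k. a * u k) w = a * ip D u w"
  by (simp add: ip_def sum_distrib_left mult.assoc)

lemma ip_diff_left: "ip D (\<lambda>k. u k - v k) w = ip D u w - ip D v w"
  by (simp add: ip_def sum_subtractf left_diff_distrib)

lemma ip_add_right: "ip D w (\<lambda>k. u k + v k) = ip D w u + ip D w v"
  and ip_scale_right: "ip D w (\<lambda>k. a * u k) = a * ip D w u"
  and ip_diff_right: "ip D w (\<lambda>k. u k - v k) = ip D w u - ip D w v"
  by (simp_all add: ip_commute[of D w] ip_add_left ip_scale_left ip_diff_left)

lemmas ip_linear = ip_add_left ip_scale_left ip_diff_left ip_add_right ip_scale_right ip_diff_right

lemma ip_lc_left: "ip D (lc I a u) w = (\<Sum>i\<in>I. a i * ip D (u i) w)"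
proof -
  have "ip D (lc I a u) w = (\<Sum>k<D. \<Sum>i\<in>I. a i * (u i k * w k))"
    by (simp add: ip_def lc_def sum_distrib_right mult.assoc)
  also have "\<dots> = (\<Sum>i\<in>I. \<Sum>k<D. a i * (u i k * w k))"
    by (rule sum.swap)
  finally show ?thesis
    by (simp add: ip_def sum_distrib_left)
qed

lemma ip_lc_right: "ip D w (lc I a u) = (\<Sum>i\<in>I. a i * ip D w (u i))"
  by (simp add: ip_commute[of D w] ip_lc_left)

lemma ip_self_nonneg: "0 \<le> ip D u u"
  by (simp add: ip_def sum_nonneg)

lemma ip_self_zeroD:
  assumes "ip D u u = 0" "k < D"
  shows "u k = 0"
proof -
  have "\<forall>k\<in>{..<D}. u k * u k = 0"
    using assms(1) by (subst sum_nonneg_eq_0_iff[symmetric]) (auto simp: ip_def)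
  then show ?thesis using assms(2) by simp
qed

lemma ip_cong:
  assumes "\<And>k. k < D \<Longrightarrow> u k = u' k" "\<And>k. k < D \<Longrightarrow> v k = v' k"
  shows "ip D u v = ip D u' v'"
  using assms by (simp add: ip_def)

lemma gram_eqD: "gram_eq I D u N v \<Longrightarrow> i \<in> I \<Longrightarrow> j \<in> I \<Longrightarrow> ip D (u i) (u j) = ip N (v i) (v j)"
  by (simp add: gram_eq_def)

lemma gram_eq_mono: "gram_eq I D u N v \<Longrightarrow> J \<subseteq> I \<Longrightarrow> gram_eq J D u N v"
  by (auto simp: gram_eq_def)

lemma gram_eq_sym: "gram_eq I D u N v \<Longrightarrow> gram_eq I N v D u"
  by (simp add: gram_eq_def)

lemma gram_eq_trans: "gram_eq I D u N v \<Longrightarrow> gram_eq I N v L w \<Longrightarrow> gram_eq I D u L w"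
  by (simp add: gram_eq_def)

lemma gram_eq_coord:
  assumes "gram_eq I D u N v" "\<And>i k. i \<in> I \<Longrightarrow> k < D \<Longrightarrow> u' i k = u i k"
  shows "gram_eq I D u' N v"
  unfolding gram_eq_def
proof (intro ballI)
  fix i j assume ij: "i \<in> I" "j \<in> I"
  have "ip D (u' i) (u' j) = ip D (u i) (u j)"
    by (rule ip_cong) (use assms(2) ij in auto)
  with gram_eqD[OF assms(1) ij] show "ip D (u' i) (u' j) = ip N (v i) (v j)" by simp
qed

lemma gram_eq_lc:
  assumes "gram_eq I D u N v"
  shows "gram_eq J D (\<lambda>j. lc I (c j) u) N (\<lambda>j. lc I (c j) v)"
  using assms by (simp add: gram_eq_def ip_lc_left ip_lc_right)

section \<open>Linear isometries and alignment of families with equal Gram matrices\<close>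

definition lin_iso :: "nat \<Rightarrow> ((nat \<Rightarrow> real) \<Rightarrow> nat \<Rightarrow> real) \<Rightarrow> bool" where
  "lin_iso D H \<longleftrightarrow> (\<forall>u v. ip D (H u) (H v) = ip D u v) \<and>
     (\<forall>u v a. H (\<lambda>k. u k + a * v k) = (\<lambda>k. H u k + a * H v k))"

lemma lin_iso_add:
  assumes "lin_iso D H"
  shows "H (\<lambda>k. u k + v k) = (\<lambda>k. H u k + H v k)"
  using assms unfolding lin_iso_def by (metis (no_types, lifting) mult_1 ext)

lemma lin_iso_zero:
  assumes "lin_iso D H"
  shows "H (\<lambda>k. 0) = (\<lambda>k. 0)"
  using lin_iso_add[OF assms, of "\<lambda>k. 0" "\<lambda>k. 0"] by (auto simp: fun_eq_iff)

lemma lin_iso_lc: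
  assumes "lin_iso D H"
  shows "H (lc I a u) = lc I a (\<lambda>i. H (u i))"
proof (induction I rule: infinite_finite_induct)
  case (insert c I)
  have "lc (insert c I) a u = (\<lambda>k. lc I a u k + a c * u c k)" for u :: "_ \<Rightarrow> nat \<Rightarrow> real"
    using insert.hyps by (auto simp: lc_def)
  then show ?case using assms insert.IH unfolding lin_iso_def by metis
next
  case empty
  show ?case using lin_iso_zero[OF assms] by (simp add: lc_def)
next
  case (infinite I)
  then show ?case using lin_iso_zero[OF assms] by (simp add: lc_def)
qed

text \<open>Reflection in the hyperplane orthogonal to \<open>d\<close>. If
  \<open>ip D d d = 0\<close>, division by zero yields 0 and the map is the identity.\<close>

definition reflect :: "nat \<Rightarrow> (nat \<Rightarrow> real) \<Rightarrow> (nat \<Rightarrow> real) \<Rightarrow> nat \<Rightarrow> real" where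
  "reflect D d u = (\<lambda>k. u k - 2 * ip D u d / ip D d d * d k)"

lemma lin_iso_reflect: "lin_iso D (reflect D d)"
  unfolding lin_iso_def
proof (intro conjI allI)
  fix u v
  have "ip D (reflect D d u) (reflect D d v) = ip D u v - 2 * ip D v d / ip D d d * ip D u d
    - (2 * ip D u d / ip D d d * ip D d v
       - 2 * ip D u d / ip D d d * (2 * ip D v d / ip D d d * ip D d d))"
    unfolding reflect_def by (simp only: ip_linear right_diff_distrib)
  also have "\<dots> = ip D u v"
    by (cases "ip D d d = 0") (simp_all add: ip_commute[of D d v] field_simps)
  finally show "ip D (reflect D d u) (reflect D d v) = ip D u v" .
next
  fix u v a
  show "reflect D d (\<lambda>k. u k + a * v k) = (\<lambda>k. reflect D d u k + a * reflect D d v k)"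
    by (rule ext) (simp add: reflect_def ip_linear algebra_simps add_divide_distrib)
qed

lemma lin_iso_compose: "lin_iso D H \<Longrightarrow> lin_iso D H' \<Longrightarrow> lin_iso D (H \<circ> H')"
  by (simp add: lin_iso_def)

lemma gram_eq_lin_iso:
  assumes "lin_iso D H" "gram_eq I D u N v"
  shows "gram_eq I D (\<lambda>i. H (u i)) N v"
  using assms by (simp add: lin_iso_def gram_eq_def)

text \<open>
  The isometry is a product of Householder reflections: the reflection exchanging
  \<open>H (v c)\<close> and \<open>u c\<close> fixes the vectors that are already in place, because they have the same
  inner product with both.
\<close>
lemma gram_eq_align:
  assumes "finite I" "gram_eq I D u D v"
  obtains H where "lin_iso D H" "\<And>i k. i \<in> I \<Longrightarrow> k < D \<Longrightarrow> H (v i) k = u i k"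
proof -
  have "\<exists>H. lin_iso D H \<and> (\<forall>i\<in>I. \<forall>k<D. H (v i) k = u i k)"
    using assms
  proof (induction I rule: finite_induct)
    case empty
    show ?case by (rule exI[of _ id]) (simp add: lin_iso_def)
  next
    case (insert c I)
    then obtain H where H: "lin_iso D H" "\<forall>i\<in>I. \<forall>k<D. H (v i) k = u i k"
      using gram_eq_mono by blast
    define d where "d = (\<lambda>k. H (v c) k - u c k)"
    have iso: "ip D (H x) (H y) = ip D x y" for x y
      using H(1) by (simp add: lin_iso_def)
    have gr: "ip D (u i) (u j) = ip D (v i) (v j)" if "i \<in> insert c I" "j \<in> insert c I" for i j
      using gram_eqD[OF insert.prems that] .
    have fix_I: "ip D (H (v i)) d = 0" if "i \<in> I" for i
    proof -
      have "ip D (H (v i)) (u c) = ip D (u i) (u c)"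
        by (rule ip_cong) (use H(2) that in auto)
      then show ?thesis using that by (simp add: d_def ip_linear iso gr)
    qed
    \<comment> \<open>\<open>H (v c)\<close> and \<open>u c\<close> have equal length, so the
      reflection subtracts \<open>d\<close> exactly once from \<open>H (v c)\<close>.\<close>
    have "ip D d d = 2 * ip D (H (v c)) d"
      by (simp add: d_def ip_linear iso gr ip_commute[of D "u c" "H (v c)"])
    then have "reflect D d (H (v c)) k = u c k" if "k < D" for k
    proof (cases "ip D d d = 0")
      case True
      then show ?thesis using ip_self_zeroD[OF True that] by (simp add: reflect_def d_def)
    next
      case False
      then have "2 * ip D (H (v c)) d / ip D d d = 1" using \<open>ip D d d = _\<close> by simp
      then show ?thesis by (simp only: reflect_def) (simp add: d_def)
    qed
    moreover have "reflect D d (H (v i)) k = u i k" if "i \<in> I" "k < D" for i k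
      using fix_I[OF that(1)] H(2) that by (simp add: reflect_def)
    ultimately show ?case
      using lin_iso_compose[OF lin_iso_reflect H(1), of d]
      by (intro exI[of _ "reflect D d \<circ> H"]) (simp add: comp_def)
  qed
  then show ?thesis using that by blast
qed

section \<open>Positive semidefinite kernels and their realization by vectors\<close>

definition psd_kernel :: "'i set \<Rightarrow> ('i \<Rightarrow> 'i \<Rightarrow> real) \<Rightarrow> bool" where
  "psd_kernel I K \<longleftrightarrow> (\<forall>i\<in>I. \<forall>j\<in>I. K i j = K j i) \<and>
     (\<forall>f. 0 \<le> (\<Sum>i\<in>I. \<Sum>j\<in>I. f i * f j * K i j))"

lemma psd_kernel_ip: "psd_kernel I (\<lambda>i j. ip N (v i) (v j))"
  unfolding psd_kernel_def
proof (intro conjI allI ballI)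
  fix f
  have "(\<Sum>i\<in>I. \<Sum>j\<in>I. f i * f j * ip N (v i) (v j)) = ip N (lc I f v) (lc I f v)"
    unfolding ip_lc_left unfolding ip_lc_right by (simp only: sum_distrib_left mult.assoc)
  then show "0 \<le> (\<Sum>i\<in>I. \<Sum>j\<in>I. f i * f j * ip N (v i) (v j))"
    by (simp add: ip_self_nonneg)
qed (rule ip_commute)

lemma psd_kernel_mono:
  assumes "psd_kernel I K" "J \<subseteq> I" "finite I"
  shows "psd_kernel J K"
  unfolding psd_kernel_def
proof (intro conjI allI)
  fix f
  have "(\<Sum>i\<in>J. \<Sum>j\<in>J. f i * f j * K i j) =
      (\<Sum>i\<in>I. \<Sum>j\<in>I. (if i \<in> J then f i else 0) * (if j \<in> J then f j else 0) * K i j)"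
    by (rule sum.mono_neutral_cong_left[OF assms(3,2)])
       (auto intro!: sum.mono_neutral_cong_left[OF assms(3,2)])
  then show "0 \<le> (\<Sum>i\<in>J. \<Sum>j\<in>J. f i * f j * K i j)"
    using conjunct2[OF assms(1)[unfolded psd_kernel_def], rule_format,
        of "\<lambda>i. if i \<in> J then f i else 0"] by simp
next
  show "\<forall>i\<in>J. \<forall>j\<in>J. K i j = K j i"
    using assms(1,2) by (meson psd_kernel_def subsetD)
qed

text \<open>The quadratic form at the vector with value \<open>s\<close> at \<open>c\<close> and
  \<open>f\<close> elsewhere, expanded as a polynomial in \<open>s\<close>; the later arguments only
  choose \<open>s\<close>.\<close>

lemma psd_kernel_insert:
  assumes "psd_kernel (insert c I) K" "finite I" "c \<notin> I"
  shows "0 \<le> s\<^sup>2 * K c c + 2 * s * (\<Sum>i\<in>I. f i * K i c) + (\<Sum>i\<in>I. \<Sum>j\<in>I. f i * f j * K i j)"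
proof -
  let ?f = "\<lambda>i. if i = c then s else f i"
  have symm: "K c j = K j c" if "j \<in> I" for j
    using assms(1) that unfolding psd_kernel_def by blast
  have ne: "i \<noteq> c" if "i \<in> I" for i
    using assms(3) that by auto
  have "(\<Sum>i\<in>insert c I. \<Sum>j\<in>insert c I. ?f i * ?f j * K i j) =
      s\<^sup>2 * K c c + (\<Sum>j\<in>I. s * f j * K j c) +
      (\<Sum>i\<in>I. f i * s * K i c + (\<Sum>j\<in>I. f i * f j * K i j))"
  proof -
    have row: "(\<Sum>j\<in>insert c I. ?f i * ?f j * K i j) = ?f i * s * K i c + (\<Sum>j\<in>I. ?f i * f j * K i j)" for i
      using assms(2,3) by (auto simp: ne intro!: sum.cong)
    have "(\<Sum>i\<in>I. ?f i * s * K i c + (\<Sum>j\<in>I. ?f i * f j * K i j)) =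
        (\<Sum>i\<in>I. f i * s * K i c + (\<Sum>j\<in>I. f i * f j * K i j))"
      by (intro sum.cong) (auto simp: ne)
    moreover have "(\<Sum>j\<in>I. s * f j * K c j) = (\<Sum>j\<in>I. s * f j * K j c)"
      by (intro sum.cong) (simp_all add: symm)
    ultimately show ?thesis
      unfolding row using assms(2,3) by (simp add: power2_eq_square)
  qed
  also have "\<dots> = s\<^sup>2 * K c c + 2 * s * (\<Sum>i\<in>I. f i * K i c) + (\<Sum>i\<in>I. \<Sum>j\<in>I. f i * f j * K i j)"
    by (simp add: sum.distrib sum_distrib_left mult_ac)
  finally have "s\<^sup>2 * K c c + 2 * s * (\<Sum>i\<in>I. f i * K i c) + (\<Sum>i\<in>I. \<Sum>j\<in>I. f i * f j * K i j) =
    (\<Sum>i\<in>insert c I. \<Sum>j\<in>insert c I. ?f i * ?f j * K i j)" by (rule sym)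
  also have "0 \<le> \<dots>"
    using conjunct2[OF assms(1)[unfolded psd_kernel_def]] by (rule spec)
  finally show ?thesis .
qed

text \<open>Otherwise the quadratic form would be unbounded below on the plane of \<open>i\<close> and \<open>c\<close>.\<close>
lemma psd_kernel_zero_pivot:
  assumes "psd_kernel I K" "finite I" "c \<in> I" "i \<in> I" "K c c = 0"
  shows "K i c = 0"
proof (cases "i = c")
  case False
  have "psd_kernel (insert c {i}) K"
    by (rule psd_kernel_mono[OF assms(1) _ assms(2)]) (simp add: assms(3,4))
  then have *: "0 \<le> s\<^sup>2 * K c c + 2 * s * (\<Sum>p\<in>{i}. 1 * K p c) + (\<Sum>p\<in>{i}. \<Sum>q\<in>{i}. 1 * 1 * K p q)" for s
    by (rule psd_kernel_insert[where f = "\<lambda>_. 1"]) (simp_all add: False[symmetric])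
  show ?thesis
  proof (rule ccontr)
    assume "K i c \<noteq> 0"
    \<comment> \<open>With a zero pivot the form is affine in \<open>s\<close>; this
      \<open>s\<close> makes its value -1.\<close>
    then have "2 * (- (K i i + 1) / (2 * K i c)) * K i c + K i i = - 1"
      by (simp add: field_simps)
    with *[of "- (K i i + 1) / (2 * K i c)"] show False
      unfolding assms(5) by simp
  qed
next
  case True
  then show ?thesis using assms(5) by simp
qed

text \<open>For a positive pivot, the Schur complement is the form minimized over \<open>s\<close>,
  attained at \<open>s = - q / K c c\<close> with \<open>q\<close> the sum of all
  \<open>f i * K i c\<close>. A zero pivot needs no separate case: every quotient is then 0.\<close>

lemma psd_kernel_schur:
  assumes "psd_kernel (insert c I) K" "finite I" "c \<notin> I"
  shows "psd_kernel I (\<lambda>i j. K i j - K i c * K j c / K c c)"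
  unfolding psd_kernel_def
proof (intro conjI ballI allI)
  fix f
  let ?q = "\<Sum>i\<in>I. f i * K i c"
  have "(\<Sum>i\<in>I. \<Sum>j\<in>I. f i * f j * (K i j - K i c * K j c / K c c)) =
      (\<Sum>i\<in>I. \<Sum>j\<in>I. f i * f j * K i j) - (\<Sum>i\<in>I. \<Sum>j\<in>I. (f i * K i c) * (f j * K j c)) / K c c"
    by (simp add: sum_subtractf[symmetric] sum_divide_distrib algebra_simps)
  also have "(\<Sum>i\<in>I. \<Sum>j\<in>I. (f i * K i c) * (f j * K j c)) = ?q\<^sup>2"
    by (simp add: sum_product power2_eq_square)
  also have "(\<Sum>i\<in>I. \<Sum>j\<in>I. f i * f j * K i j) - ?q\<^sup>2 / K c c =
      (- ?q / K c c)\<^sup>2 * K c c + 2 * (- ?q / K c c) * ?q + (\<Sum>i\<in>I. \<Sum>j\<in>I. f i * f j * K i j)"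
    by (simp add: field_simps power2_eq_square)
  also have "0 \<le> \<dots>"
    by (rule psd_kernel_insert[OF assms])
  finally show "0 \<le> (\<Sum>i\<in>I. \<Sum>j\<in>I. f i * f j * (K i j - K i c * K j c / K c c))" .
next
  fix i j assume "i \<in> I" "j \<in> I"
  then have "K i j = K j i"
    using assms(1) unfolding psd_kernel_def by blast
  then show "K i j - K i c * K j c / K c c = K j i - K j c * K i c / K c c"
    by simp
qed

text \<open>Cholesky factorization: the last coordinate absorbs the pivot \<open>c\<close>, and the
  Schur complement is realized in the coordinates below, at a cost of one dimension per
  index.\<close>

lemma psd_kernel_realize:
  assumes "finite I" "psd_kernel I K" "card I \<le> D"
  shows "\<exists>u. \<forall>i\<in>I. \<forall>j\<in>I. ip D (u i) (u j) = K i j"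
  using assms
proof (induction I arbitrary: K D rule: finite_induct)
  case (insert c I)
  then obtain E where E: "D = Suc E" "card I \<le> E"
    by (cases D) auto
  obtain u where u: "\<forall>i\<in>I. \<forall>j\<in>I. ip E (u i) (u j) = K i j - K i c * K j c / K c c"
    using insert.IH[OF psd_kernel_schur[OF insert.prems(1) insert.hyps] E(2)] by (elim exE)
  \<comment> \<open>The vector of \<open>c\<close> has the single entry \<open>sqrt (K c c)\<close>
    at \<open>E\<close>. For a zero pivot coordinate \<open>E\<close> is 0 for every
    \<open>i\<close>, which is correct because the whole row of \<open>c\<close> then
    vanishes.\<close>
  define w where "w i k = (if k = E then K i c / sqrt (K c c) else if i = c then 0 else u i k)" for i k
  have split: "ip D (w i) (w j) = ip E (w i) (w j) + K i c * K j c / K c c" if "0 \<le> K c c" for i j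
    using that by (simp add: E ip_def w_def)
  have pos: "0 \<le> K c c"
    using psd_kernel_insert[OF insert.prems(1) insert.hyps, of 1 "\<lambda>_. 0"] by simp
  have symm: "K i j = K j i" if "i \<in> insert c I" "j \<in> insert c I" for i j
    using insert.prems(1) that unfolding psd_kernel_def by blast
  have zero: "K i c = 0" if "K c c = 0" "i \<in> insert c I" for i
    using psd_kernel_zero_pivot[OF insert.prems(1) _ _ that(2,1)] insert.hyps by simp
  have "ip D (w i) (w j) = K i j" if ij: "i \<in> insert c I" "j \<in> insert c I" for i j
  proof (cases "i = c \<or> j = c")
    case True
    then have "ip E (w i) (w j) = 0" by (auto simp: ip_def w_def)
    moreover have "K i c * K j c / K c c = K i j"
    proof (cases "K c c = 0")
      case zero_pivot: True
      show ?thesis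
      proof (cases "i = c")
        case True
        then show ?thesis using symm[OF ij] zero[OF zero_pivot ij(2)] zero_pivot by simp
      next
        case False
        then have "j = c" using \<open>i = c \<or> j = c\<close> by simp
        then show ?thesis using zero[OF zero_pivot ij(1)] zero_pivot by simp
      qed
    next
      case False
      then show ?thesis using \<open>i = c \<or> j = c\<close> symm[OF ij] by (elim disjE) simp_all
    qed
    ultimately show ?thesis by (simp add: split[OF pos])
  next
    case False
    then have "ip E (w i) (w j) = ip E (u i) (u j)"
      by (intro ip_cong) (simp_all add: w_def)
    with False u ij show ?thesis by (simp add: split[OF pos])
  qed
  then have "\<forall>i\<in>insert c I. \<forall>j\<in>insert c I. ip D (w i) (w j) = K i j"
    by (intro ballI)
  then show ?case by (rule exI[of _ w])
next
  case empty
  show ?case by (rule exI[of _ "\<lambda>_ _. 0"]) (rule ballI, erule emptyE)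
qed

lemma gram_eq_realize:
  assumes "finite I" "card I \<le> D"
  obtains u where "gram_eq I D u N v"
proof -
  obtain u where "\<forall>i\<in>I. \<forall>j\<in>I. ip D (u i) (u j) = ip N (v i) (v j)"
    using psd_kernel_realize[OF assms(1) psd_kernel_ip assms(2), of N v] by (elim exE)
  then show ?thesis by (intro that[of u]) (simp add: gram_eq_def)
qed

text \<open>Gram-Schmidt for a possibly dependent family. Coefficients are produced instead of the
  projected vector because they are later reused with another realization of the same family, and as
  the entries of the low-rank factor.\<close>

lemma projection_coeffs:
  assumes "finite I"
  obtains a where "\<And>i. i \<in> I \<Longrightarrow> ip D (\<lambda>k. v k - lc I a u k) (u i) = 0"
proof -
  have "\<exists>a. \<forall>i\<in>I. ip D (\<lambda>k. v k - lc I a u k) (u i) = 0"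
    using assms
  proof (induction I arbitrary: v rule: finite_induct)
    case (insert c I)
    obtain b where b: "\<forall>i\<in>I. ip D (\<lambda>k. u c k - lc I b u k) (u i) = 0"
      using insert.IH by blast
    obtain a where a: "\<forall>i\<in>I. ip D (\<lambda>k. v k - lc I a u k) (u i) = 0"
      using insert.IH by blast
    define r where "r = (\<lambda>k. u c k - lc I b u k)"
    define s where "s = (\<lambda>k. v k - lc I a u k)"
    define t where "t = ip D s r / ip D r r"
    \<comment> \<open>These coefficients lower the residual \<open>s\<close> further by
      \<open>t * r\<close>, where \<open>r\<close> is the part of \<open>u c\<close> orthogonal to
      the earlier vectors.\<close>
    define a' where "a' i = (if i = c then t else a i - t * b i)" for i
    have "lc I a' u = (\<lambda>k. lc I a u k - t * lc I b u k)"
    proof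
      fix k
      have "lc I a' u k = (\<Sum>i\<in>I. (a i - t * b i) * u i k)"
        unfolding lc_def using insert.hyps by (intro sum.cong) (auto simp: a'_def)
      then show "lc I a' u k = lc I a u k - t * lc I b u k"
        by (simp add: lc_def left_diff_distrib sum_subtractf sum_distrib_left mult.assoc)
    qed
    then have "lc (insert c I) a' u = (\<lambda>k. t * u c k + (lc I a u k - t * lc I b u k))"
      using insert.hyps by (auto simp: lc_def a'_def fun_eq_iff)
    then have res: "(\<lambda>k. v k - lc (insert c I) a' u k) = (\<lambda>k. s k - t * r k)"
      by (auto simp: s_def r_def algebra_simps)
    have I: "ip D (\<lambda>k. s k - t * r k) (u i) = 0" if "i \<in> I" for i
      using a b that by (simp add: ip_linear s_def[symmetric] r_def[symmetric])
    have "ip D (\<lambda>k. s k - t * r k) r = 0"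
    proof (cases "ip D r r = 0")
      case True
      then have "\<forall>k<D. r k = 0" using ip_self_zeroD by blast
      then show ?thesis by (simp add: ip_def)
    next
      case False
      then have "ip D s r - t * ip D r r = 0" by (simp add: t_def)
      then show ?thesis by (simp only: ip_linear)
    qed
    moreover have "u c = (\<lambda>k. r k + lc I b u k)" by (auto simp: r_def)
    ultimately have "ip D (\<lambda>k. s k - t * r k) (u c) = 0"
      using I by (simp add: ip_add_right ip_lc_right)
    with I res show ?case by (intro exI[of _ a']) simp
  qed simp
  then show ?thesis using that by blast
qed

section \<open>Positive semidefinite matrices as Gram matrices\<close>

lemma psd_matsD:
  assumes "X \<in> psd_mats n"
  shows "psd_kernel {..<n} (\<lambda>i j. X $$ (i, j))"
  unfolding psd_kernel_def
proof (intro conjI ballI allI)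
  have X: "X \<in> carrier_mat n n" "transpose_mat X = X"
    "\<And>v. v \<in> carrier_vec n \<Longrightarrow> 0 \<le> v \<bullet> (X *\<^sub>v v)"
    using assms by (auto simp: psd_mats_def sym_mats_def)
  fix f :: "nat \<Rightarrow> real"
  have "vec n f \<bullet> (X *\<^sub>v vec n f) = (\<Sum>i<n. f i * (\<Sum>j<n. X $$ (i, j) * f j))"
    using X(1) by (simp add: scalar_prod_def atLeast0LessThan)
  also have "\<dots> = (\<Sum>i<n. \<Sum>j<n. f i * f j * X $$ (i, j))"
    by (simp add: sum_distrib_left mult_ac)
  finally show "0 \<le> (\<Sum>i<n. \<Sum>j<n. f i * f j * X $$ (i, j))"
    using X(3)[of "vec n f"] by simp
next
  fix i j assume "i \<in> {..<n}" "j \<in> {..<n}"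
  moreover have "X \<in> carrier_mat n n" "transpose_mat X = X"
    using assms by (simp_all add: psd_mats_def sym_mats_def)
  ultimately show "X $$ (i, j) = X $$ (j, i)"
    by (metis carrier_matD index_transpose_mat(1) lessThan_iff)
qed

definition gram_mat :: "nat \<Rightarrow> nat \<Rightarrow> (nat \<Rightarrow> nat \<Rightarrow> real) \<Rightarrow> real mat" where
  "gram_mat n D x = mat n n (\<lambda>(i, j). ip D (x i) (x j))"

lemma gram_mat_carrier: "gram_mat n D x \<in> carrier_mat n n"
  by (simp add: gram_mat_def)

lemma gram_mat_index: "i < n \<Longrightarrow> j < n \<Longrightarrow> gram_mat n D x $$ (i, j) = ip D (x i) (x j)"
  by (simp add: gram_mat_def)

lemma gram_mat_psd: "gram_mat n D x \<in> psd_mats n"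
proof -
  have "0 \<le> v \<bullet> (gram_mat n D x *\<^sub>v v)" if "v \<in> carrier_vec n" for v
  proof -
    have "v \<bullet> (gram_mat n D x *\<^sub>v v) = (\<Sum>i<n. v $ i * (\<Sum>j<n. ip D (x i) (x j) * v $ j))"
      using that by (simp add: scalar_prod_def atLeast0LessThan gram_mat_def)
    also have "\<dots> = (\<Sum>i<n. \<Sum>j<n. v $ i * v $ j * ip D (x i) (x j))"
      by (simp add: sum_distrib_left mult_ac)
    also have "0 \<le> \<dots>"
      using conjunct2[OF psd_kernel_ip[of "{..<n}" D x, unfolded psd_kernel_def]] by (rule spec)
    finally show ?thesis .
  qed
  moreover have "transpose_mat (gram_mat n D x) = gram_mat n D x"
    by (intro eq_matI) (simp_all add: gram_mat_def ip_commute)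
  ultimately show ?thesis
    by (simp add: psd_mats_def sym_mats_def gram_mat_carrier)
qed

text \<open>Each coordinate contributes one matrix of rank at most 1.\<close>

lemma rank_gram_mat: "vec_space.rank n (gram_mat n D x) \<le> D"
proof -
  interpret vec_space "TYPE(real)" n .
  show ?thesis
  proof (induction D)
    case 0
    have "gram_mat n 0 x = 0\<^sub>m n n"
      by (intro eq_matI) (simp_all add: gram_mat_def ip_def)
    then show ?case by (simp add: rank_0I)
  next
    case (Suc D)
    let ?R = "mat n n (\<lambda>(i, j). x i D * x j D)"
    have R: "?R \<in> carrier_mat n n" by simp
    have "gram_mat n (Suc D) x = gram_mat n D x + ?R"
      by (intro eq_matI) (simp_all add: gram_mat_def ip_def)
    then have "rank (gram_mat n (Suc D) x) \<le> rank (gram_mat n D x) + rank ?R"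
      using rank_subadditive[OF gram_mat_carrier R] by simp
    moreover have "rank ?R \<le> 1"
      by (rule rank_le_1_product_entries[OF R, of "\<lambda>i. x i D" "\<lambda>i. x i D"]) simp
    ultimately show ?case using Suc.IH by simp
  qed
qed

text \<open>A maximal independent set of columns, with one position chosen for each since columns
  may repeat. Indices are needed because in a semidefinite matrix they also select a principal
  submatrix.\<close>

lemma column_basis:
  fixes A :: "real mat"
  assumes A: "A \<in> carrier_mat n nc"
  obtains C where "C \<subseteq> {..<nc}" "card C = vec_space.rank n A"
    "\<And>j. j < nc \<Longrightarrow> \<exists>\<alpha>. \<forall>i<n. A $$ (i, j) = (\<Sum>c\<in>C. \<alpha> c * A $$ (i, c))"
proof -
  interpret vec_space "TYPE(real)" n .
  let ?P = "\<lambda>T. T \<subseteq> set (cols A) \<and> lin_indpt T"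
  have car: "set (cols A) \<subseteq> carrier_vec n"
    using cols_dim[of A] A by simp
  have "lin_indpt {}"
    by (simp add: lin_dep_def)
  then obtain S where S: "finite S" "maximal S ?P"
    using maximal_exists_superset[of "set (cols A)" ?P "{}"] by auto
  then have SP: "S \<subseteq> set (cols A)" "lin_indpt S"
    by (auto simp: maximal_def)
  have Sc: "S \<subseteq> carrier_vec n" using SP(1) car by auto
  have span: "v \<in> span S" if v: "v \<in> set (cols A)" for v
  proof (rule ccontr)
    assume nin: "v \<notin> span S"
    have "v \<notin> S" using nin Sc span_mem[of S] by auto
    moreover have "lin_indpt (insert v S)"
      using lin_dep_iff_in_span[of S v] Sc SP(2) v car nin calculation by auto
    ultimately show False
      using S(2) SP(1) v unfolding maximal_def by blast
  qed
  have "\<exists>j<nc. col A j = s" if "s \<in> S" for s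
    using that SP(1) A by (metis carrier_matD(2) cols_length cols_nth in_set_conv_nth subsetD)
  then obtain f where f: "\<And>s. s \<in> S \<Longrightarrow> f s < nc \<and> col A (f s) = s"
    by metis
  have inj: "inj_on f S" using f by (metis inj_onI)
  show ?thesis
  proof (rule that[of "f ` S"])
    show "f ` S \<subseteq> {..<nc}" using f by auto
    show "card (f ` S) = rank A"
      by (simp add: card_image[OF inj] rank_card_indpt[OF A S(2)])
    fix j assume j: "j < nc"
    then have "col A j \<in> set (cols A)"
      using A by (metis carrier_matD(2) cols_length cols_nth nth_mem)
    then have "\<exists>a. col A j = lincomb a S"
      using span finite_span[OF S(1)] Sc by auto
    then obtain a where a: "col A j = lincomb a S" by blast
    have "A $$ (i, j) = (\<Sum>c\<in>f ` S. a (col A c) * A $$ (i, c))" if i: "i < n" for i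
    proof -
      have col: "A $$ (i, c) = col A c $ i" if "c < nc" for c
        using i that A by simp
      have "A $$ (i, j) = lincomb a S $ i" unfolding col[OF j] a ..
      also have "\<dots> = (\<Sum>s\<in>S. a s * s $ i)" by (rule lincomb_index[OF i Sc])
      also have "\<dots> = (\<Sum>s\<in>S. a (col A (f s)) * A $$ (i, f s))"
        by (intro sum.cong refl) (simp add: f col)
      finally show ?thesis by (simp add: sum.reindex[OF inj])
    qed
    then show "\<exists>\<alpha>. \<forall>i<n. A $$ (i, j) = (\<Sum>c\<in>f ` S. \<alpha> c * A $$ (i, c))"
      by (intro exI[of _ "\<lambda>c. a (col A c)"] allI impI)
  qed
qed

text \<open>The principal submatrix on a column basis has as many indices as the rank, hence a
  realization in dimension \<open>D\<close>. By symmetry the coefficients that express the columns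
  also express the rows, so they extend it to all indices.\<close>

lemma psd_mats_realize:
  assumes Y: "Y \<in> psd_mats n" and rank: "vec_space.rank n Y \<le> D"
  obtains u where "\<And>i j. i < n \<Longrightarrow> j < n \<Longrightarrow> ip D (u i) (u j) = Y $$ (i, j)"
proof -
  have car: "Y \<in> carrier_mat n n" using Y by (simp add: psd_mats_def sym_mats_def)
  obtain C where C: "C \<subseteq> {..<n}" "card C = vec_space.rank n Y"
    "\<And>j. j < n \<Longrightarrow> \<exists>\<alpha>. \<forall>i<n. Y $$ (i, j) = (\<Sum>c\<in>C. \<alpha> c * Y $$ (i, c))"
    by (rule column_basis[OF car]) blast
  have fin: "finite C" using C(1) finite_subset by blast
  have psd: "psd_kernel C (\<lambda>i j. Y $$ (i, j))"
    by (rule psd_kernel_mono[OF psd_matsD[OF Y] C(1)]) simp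
  obtain w where w: "\<forall>i\<in>C. \<forall>j\<in>C. ip D (w i) (w j) = Y $$ (i, j)"
    using psd_kernel_realize[OF fin psd rank[folded C(2)]] by (elim exE)
  obtain \<alpha> where \<alpha>: "\<And>i j. i < n \<Longrightarrow> j < n \<Longrightarrow> Y $$ (i, j) = (\<Sum>c\<in>C. \<alpha> j c * Y $$ (i, c))"
    using C(3) by metis
  have symm: "Y $$ (i, j) = Y $$ (j, i)" if "i < n" "j < n" for i j
    using psd_matsD[OF Y] that unfolding psd_kernel_def by blast
  show ?thesis
  proof (rule that[of "\<lambda>j. lc C (\<alpha> j) w"])
    fix i j assume ij: "i < n" "j < n"
    have "ip D (lc C (\<alpha> i) w) (lc C (\<alpha> j) w) = (\<Sum>c\<in>C. \<alpha> i c * (\<Sum>d\<in>C. \<alpha> j d * Y $$ (c, d)))"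
      unfolding ip_lc_left unfolding ip_lc_right using w by (intro sum.cong refl) simp
    also have "\<dots> = (\<Sum>c\<in>C. \<alpha> i c * Y $$ (j, c))"
      using \<alpha>[OF _ ij(2)] symm[OF _ ij(2)] C(1) by (intro sum.cong refl) auto
    also have "\<dots> = Y $$ (i, j)"
      using \<alpha>[OF ij(2,1)] symm[OF ij] by simp
    finally show "ip D (lc C (\<alpha> i) w) (lc C (\<alpha> j) w) = Y $$ (i, j)" .
  qed
qed

section \<open>The function phi in terms of vectors\<close>

lemma submatrix_eq_one_iff:
  fixes Y :: "real mat"
  assumes "Y \<in> carrier_mat n n" "o' + l \<le> n"
  shows "submatrix Y {o'..<o' + l} {o'..<o' + l} = 1\<^sub>m l \<longleftrightarrow>
    (\<forall>a<l. \<forall>b<l. Y $$ (o' + a, o' + b) = (if a = b then 1 else 0))"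
proof -
  let ?S = "submatrix Y {o'..<o' + l} {o'..<o' + l}"
  have "{i. i < n \<and> i \<in> {o'..<o' + l}} = {o'..<o' + l}" using assms(2) by auto
  then have dim: "dim_row ?S = l" "dim_col ?S = l"
    using assms(1) by (simp_all add: dim_submatrix)
  have "card {i \<in> {o'..<o' + l}. i < o' + a} = a" if "a < l" for a
  proof -
    have "{i \<in> {o'..<o' + l}. i < o' + a} = {o'..<o' + a}" using that by auto
    then show ?thesis by simp
  qed
  then have idx: "?S $$ (a, b) = Y $$ (o' + a, o' + b)" if "a < l" "b < l" for a b
    using submatrix_index_card[of "o' + a" Y "o' + b" "{o'..<o' + l}" "{o'..<o' + l}"] that assms by simp
  show ?thesis
  proof
    assume "?S = 1\<^sub>m l"
    then show "\<forall>a<l. \<forall>b<l. Y $$ (o' + a, o' + b) = (if a = b then 1 else 0)"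
      by (auto simp flip: idx)
  next
    assume "\<forall>a<l. \<forall>b<l. Y $$ (o' + a, o' + b) = (if a = b then 1 else 0)"
    then show "?S = 1\<^sub>m l"
      by (intro eq_matI) (auto simp: idx dim)
  qed
qed

lemma phi_attained:
  assumes "l > 0" "U \<in> carrier_mat (2 * l) l" "M \<in> sym_mats l" "phi_set l U M \<noteq> {}"
  obtains Y where "Y \<in> phi_set l U M" "vec_space.rank (2 * l) Y \<le> phi l"
proof -
  let ?P = "\<lambda>k. \<forall>U \<in> carrier_mat (2 * l) l. \<forall>M \<in> sym_mats l.
        phi_set l U M = {} \<or> (\<exists>Y \<in> phi_set l U M. vec_space.rank (2 * l) Y \<le> k)"
  have "Y \<in> carrier_mat (2 * l) (2 * l)" if "Y \<in> phi_set l U M" for U M and Y :: "real mat"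
    using that by (simp add: phi_set_def psd_mats_def sym_mats_def)
  then have "?P (2 * l)"
    using vec_space.rank_le_nc by blast
  then have "?P (Least ?P)" by (rule LeastI)
  then show ?thesis
    using assms that unfolding phi_def by auto
qed

text \<open>The two identity blocks of \<open>phi_set\<close>, in terms of vectors. Inner products
  between the two halves remain free; they are what the condition on \<open>U\<close>
  restricts.\<close>

definition block_orthonormal :: "nat \<Rightarrow> nat \<Rightarrow> (nat \<Rightarrow> nat \<Rightarrow> real) \<Rightarrow> bool" where
  "block_orthonormal l N z \<longleftrightarrow>
     (\<forall>a<l. \<forall>b<l. ip N (z a) (z b) = (if a = b then 1 else 0)) \<and>
     (\<forall>a<l. \<forall>b<l. ip N (z (l + a)) (z (l + b)) = (if a = b then 1 else 0))"

lemma congruence_index: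
  assumes "Y \<in> carrier_mat n n" "\<And>a b. a < n \<Longrightarrow> b < n \<Longrightarrow> Y $$ (a, b) = ip N (z a) (z b)"
    and "i < m" "j < m"
  shows "(transpose_mat (mat n m (\<lambda>(a, k). c k a)) * Y * mat n m (\<lambda>(a, k). c k a)) $$ (i, j) =
    ip N (lc {..<n} (c i) z) (lc {..<n} (c j) z)"
proof -
  have "(transpose_mat (mat n m (\<lambda>(a, k). c k a)) * Y * mat n m (\<lambda>(a, k). c k a)) $$ (i, j) =
      (\<Sum>b<n. (\<Sum>a<n. c i a * Y $$ (a, b)) * c j b)"
    using assms(1,3,4) by (simp add: scalar_prod_def atLeast0LessThan)
  also have "\<dots> = (\<Sum>b<n. \<Sum>a<n. c i a * (c j b * ip N (z a) (z b)))"
    using assms(2) by (simp add: sum_distrib_left sum_distrib_right mult_ac)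
  also have "\<dots> = (\<Sum>a<n. \<Sum>b<n. c i a * (c j b * ip N (z a) (z b)))"
    by (rule sum.swap)
  finally show ?thesis
    unfolding ip_lc_left unfolding ip_lc_right by (simp only: sum_distrib_left)
qed

text \<open>The matrix \<open>U^T Y U\<close> is the Gram matrix of the combinations whose
  coefficients are the columns of \<open>U\<close>. The Gram matrix of \<open>z\<close> shows the
  set to be nonempty, and its element of rank at most \<open>phi l\<close> is the Gram matrix of
  \<open>\<zeta>\<close>.\<close>

lemma phi_vectors:
  assumes "l > 0" "block_orthonormal l N z"
  obtains \<zeta> where "block_orthonormal l (phi l) \<zeta>"
    "gram_eq {..<l} (phi l) (\<lambda>k. lc {..<2 * l} (c k) \<zeta>) N (\<lambda>k. lc {..<2 * l} (c k) z)"
proof -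
  let ?U = "mat (2 * l) l (\<lambda>(a, k). c k a) :: real mat"
  define M where "M = gram_mat l N (\<lambda>k. lc {..<2 * l} (c k) z)"
  have M: "M \<in> sym_mats l"
    unfolding M_def using gram_mat_psd by (auto simp: psd_mats_def)
  have block: "block_orthonormal l D v \<longleftrightarrow>
      submatrix Y {0..<l} {0..<l} = 1\<^sub>m l \<and> submatrix Y {l..<2 * l} {l..<2 * l} = 1\<^sub>m l"
    if "Y \<in> carrier_mat (2 * l) (2 * l)" "\<And>a b. a < 2 * l \<Longrightarrow> b < 2 * l \<Longrightarrow> Y $$ (a, b) = ip D (v a) (v b)"
    for Y D v
    using submatrix_eq_one_iff[OF that(1), of 0 l] submatrix_eq_one_iff[OF that(1), of l l] that(2)
    by (simp add: block_orthonormal_def mult_2)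
  let ?Y = "gram_mat (2 * l) N z"
  have "transpose_mat ?U * ?Y * ?U = M"
    by (intro eq_matI)
      (simp_all add: M_def gram_mat_index congruence_index[OF gram_mat_carrier gram_mat_index]
        gram_mat_carrier[THEN carrier_matD(1)] gram_mat_carrier[THEN carrier_matD(2)]
        del: index_mult_mat(1))
  then have "?Y \<in> phi_set l ?U M"
    using block[OF gram_mat_carrier gram_mat_index] assms(2) gram_mat_psd by (simp add: phi_set_def)
  then obtain Y where Y: "Y \<in> phi_set l ?U M" "vec_space.rank (2 * l) Y \<le> phi l"
    using phi_attained[OF assms(1) _ M, of ?U] by auto
  then have psd: "Y \<in> psd_mats (2 * l)" and car: "Y \<in> carrier_mat (2 * l) (2 * l)"
    by (simp_all add: phi_set_def psd_mats_def sym_mats_def)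
  obtain \<zeta> where \<zeta>: "\<And>a b. a < 2 * l \<Longrightarrow> b < 2 * l \<Longrightarrow> ip (phi l) (\<zeta> a) (\<zeta> b) = Y $$ (a, b)"
    using psd_mats_realize[OF psd Y(2)] by blast
  show ?thesis
  proof (rule that[of \<zeta>])
    show "block_orthonormal l (phi l) \<zeta>"
      using block[OF car \<zeta>[symmetric]] Y(1) by (simp add: phi_set_def)
    show "gram_eq {..<l} (phi l) (\<lambda>k. lc {..<2 * l} (c k) \<zeta>) N (\<lambda>k. lc {..<2 * l} (c k) z)"
      unfolding gram_eq_def
    proof (intro ballI)
      fix i j assume ij: "i \<in> {..<l}" "j \<in> {..<l}"
      have "ip (phi l) (lc {..<2 * l} (c i) \<zeta>) (lc {..<2 * l} (c j) \<zeta>) = M $$ (i, j)"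
        using congruence_index[OF car \<zeta>[symmetric], of i l j c] ij Y(1)
        by (simp add: phi_set_def del: index_mult_mat(1))
      then show "ip (phi l) (lc {..<2 * l} (c i) \<zeta>) (lc {..<2 * l} (c j) \<zeta>) =
          ip N (lc {..<2 * l} (c i) z) (lc {..<2 * l} (c j) z)"
        using ij by (simp add: M_def gram_mat_index)
    qed
  qed
qed

section \<open>Orthonormal families and the splitting of sums\<close>

definition unit_fun :: "nat \<Rightarrow> nat \<Rightarrow> real" where
  "unit_fun a = (\<lambda>k. if k = a then 1 else 0)"

lemma ip_unit_fun_left:
  assumes "a < D"
  shows "ip D (unit_fun a) v = v a"
proof -
  have "ip D (unit_fun a) v = (\<Sum>k<D. if k = a then v k else 0)"
    unfolding ip_def unit_fun_def by (intro sum.cong) auto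
  then show ?thesis using assms by simp
qed

lemma ip_unit_fun: "a < D \<Longrightarrow> ip D (unit_fun a) (unit_fun b) = (if a = b then 1 else 0)"
  by (simp add: ip_unit_fun_left) (simp add: unit_fun_def)

text \<open>Bessel's inequality for the \<open>l\<close> orthonormal vectors, summed over the coordinate axes.\<close>
lemma orthonormal_card_le:
  assumes "\<And>a b. a < l \<Longrightarrow> b < l \<Longrightarrow> ip D (z a) (z b) = (if a = b then 1 else 0)"
  shows "l \<le> D"
proof -
  have bessel: "(\<Sum>a<l. (z a k)\<^sup>2) \<le> 1" if k: "k < D" for k
  proof -
    let ?p = "lc {..<l} (\<lambda>a. z a k) z"
    have e: "ip D (z a) (unit_fun k) = z a k" "ip D (unit_fun k) (z a) = z a k" for a
      using k by (simp_all add: ip_commute[of D "z a"] ip_unit_fun_left)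
    have pz: "ip D ?p (z b) = z b k" if "b < l" for b
    proof -
      have "ip D ?p (z b) = (\<Sum>a<l. if a = b then z a k else 0)"
        unfolding ip_lc_left by (intro sum.cong) (use assms that in auto)
      then show ?thesis using that by simp
    qed
    have "0 \<le> ip D (\<lambda>j. unit_fun k j - ?p j) (\<lambda>j. unit_fun k j - ?p j)"
      by (rule ip_self_nonneg)
    also have "\<dots> = ip D (unit_fun k) (unit_fun k) - ip D ?p (unit_fun k) - (ip D (unit_fun k) ?p - ip D ?p ?p)"
      by (simp only: ip_linear)
    also have "\<dots> = 1 - (\<Sum>a<l. (z a k)\<^sup>2)"
      using k by (simp add: ip_unit_fun ip_lc_right pz ip_lc_left[of _ _ _ _ "unit_fun k"] e power2_eq_square)
    finally show ?thesis by simp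
  qed
  have "real l = (\<Sum>a<l. ip D (z a) (z a))" using assms by simp
  also have "\<dots> = (\<Sum>k<D. \<Sum>a<l. (z a k)\<^sup>2)"
    unfolding ip_def by (subst sum.swap) (simp add: power2_eq_square)
  also have "\<dots> \<le> (\<Sum>k<D. 1)" by (rule sum_mono) (use bessel in simp)
  finally show ?thesis by simp
qed

text \<open>An identity block of size \<open>l\<close> forces rank at least \<open>l\<close>.
  Consequently a bag of at most \<open>w\<close> vectors together with \<open>l\<close> further
  vectors fits into dimension \<open>w + phi l\<close>.\<close>

lemma le_phi: "l \<le> phi l"
proof (cases "l = 0")
  case False
  \<comment> \<open>Standard basis vectors give a member of the set, with zero coefficients so that
    \<open>U\<close> and \<open>M\<close> vanish.\<close>
  have "block_orthonormal l (2 * l) unit_fun"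
    by (simp add: block_orthonormal_def ip_unit_fun)
  then obtain \<zeta> where "block_orthonormal l (phi l) \<zeta>"
    using phi_vectors[of l "2 * l" unit_fun "\<lambda>_ _. 0"] False by auto
  then show ?thesis
    by (intro orthonormal_card_le[of l "phi l" \<zeta>]) (simp add: block_orthonormal_def)
qed simp

lemma ip_pad:
  assumes "N \<le> E"
  shows "ip E (\<lambda>k. if k < N then u k else 0) (\<lambda>k. if k < N then v k else 0) = ip N u v"
  unfolding ip_def by (rule sum.mono_neutral_cong_right) (use assms in auto)

text \<open>Even dependent vectors are combinations of \<open>l\<close> orthonormal ones: their Gram
  matrix is realized by coefficient vectors in \<open>l\<close> dimensions, and an isometry carrying
  these to the given vectors sends the standard basis to the frame.\<close>

lemma orthonormal_frame:
  assumes "l \<le> E" "N \<le> E"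
  obtains z c where "\<And>a b. a < l \<Longrightarrow> b < l \<Longrightarrow> ip E (z a) (z b) = (if a = b then 1 else 0)"
    "\<And>k j. k < l \<Longrightarrow> j < E \<Longrightarrow> lc {..<l} (c k) z j = (if j < N then r k j else 0)"
proof -
  obtain c where c: "gram_eq {..<l} l c N r"
    by (rule gram_eq_realize[of "{..<l}" l N r]) auto
  have "gram_eq {..<l} E (\<lambda>k j. if j < N then r k j else 0) E (\<lambda>k j. if j < l then c k j else 0)"
    using c by (simp add: gram_eq_def ip_pad assms)
  then obtain H where H: "lin_iso E H"
    "\<And>k j. k \<in> {..<l} \<Longrightarrow> j < E \<Longrightarrow> H (\<lambda>j. if j < l then c k j else 0) j = (if j < N then r k j else 0)"
    by (rule gram_eq_align[rotated]) auto
  show ?thesis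
  proof (rule that[of "\<lambda>a. H (unit_fun a)" c])
    fix a b assume "a < l" "b < l"
    then show "ip E (H (unit_fun a)) (H (unit_fun b)) = (if a = b then 1 else 0)"
      using H(1) assms(1) by (simp add: lin_iso_def ip_unit_fun)
  next
    fix k j assume "k < l" "j < E"
    moreover have "lc {..<l} (c k) unit_fun = (\<lambda>j. if j < l then c k j else 0)"
    proof
      fix j
      have "lc {..<l} (c k) unit_fun j = (\<Sum>i<l. if i = j then c k i else 0)"
        unfolding lc_def unit_fun_def by (intro sum.cong) auto
      then show "lc {..<l} (c k) unit_fun j = (if j < l then c k j else 0)" by simp
    qed
    ultimately show "lc {..<l} (c k) (\<lambda>a. H (unit_fun a)) j = (if j < N then r k j else 0)"
      using H(2)[of k j] by (simp add: lin_iso_lc[OF H(1), symmetric])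
  qed
qed

lemma sum_lessThan_add: "(\<Sum>a<m + n. g a) = (\<Sum>a<m. g a) + (\<Sum>a<n. g (m + a :: nat))"
  for g :: "nat \<Rightarrow> real"
  by (induction n) simp_all

text \<open>
  After expressing both families in orthonormal frames, their joint Gram matrix becomes a member
  of the set defining \<open>phi\<close>, with the coefficients of the frames as the matrix \<open>U\<close>.
\<close>
lemma phi_join:
  obtains \<rho> \<sigma> where "gram_eq {..<l} (phi l) \<rho> N r" "gram_eq {..<l} (phi l) \<sigma> N s"
    "gram_eq {..<l} (phi l) (\<lambda>k j. \<rho> k j + \<sigma> k j) N (\<lambda>k j. r k j + s k j)"
proof (cases "l = 0")
  case True
  then show ?thesis using that[of "\<lambda>_ _. 0" "\<lambda>_ _. 0"] by (simp add: gram_eq_def)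
next
  case False
  \<comment> \<open>Room for \<open>l\<close> orthonormal vectors even if \<open>N\<close> is
    smaller than \<open>l\<close>.\<close>
  define E where "E = max l N"
  have le: "l \<le> E" "N \<le> E" by (auto simp: E_def)
  let ?pad = "\<lambda>(r :: nat \<Rightarrow> nat \<Rightarrow> real) k j. if j < N then r k j else 0"
  obtain z1 c1 where z1: "\<And>a b. a < l \<Longrightarrow> b < l \<Longrightarrow> ip E (z1 a) (z1 b) = (if a = b then 1 else 0)"
    "\<And>k j. k < l \<Longrightarrow> j < E \<Longrightarrow> lc {..<l} (c1 k) z1 j = ?pad r k j"
    using orthonormal_frame[OF le, of r] by blast
  obtain z2 c2 where z2: "\<And>a b. a < l \<Longrightarrow> b < l \<Longrightarrow> ip E (z2 a) (z2 b) = (if a = b then 1 else 0)"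
    "\<And>k j. k < l \<Longrightarrow> j < E \<Longrightarrow> lc {..<l} (c2 k) z2 j = ?pad s k j"
    using orthonormal_frame[OF le, of s] by blast
  \<comment> \<open>The two frames are stacked, and so are their coefficients below. Column
    \<open>k\<close> of the resulting \<open>U\<close> then represents
    \<open>r k + s k\<close>.\<close>
  define z where "z a = (if a < l then z1 a else z2 (a - l))" for a
  define c where "c k a = (if a < l then c1 k a else c2 k (a - l))" for k a
  have split: "lc {..<2 * l} (c k) v = (\<lambda>j. lc {..<l} (c1 k) v j + lc {..<l} (c2 k) (\<lambda>a. v (l + a)) j)" for k v
    by (rule ext) (simp add: lc_def mult_2 sum_lessThan_add c_def)
  have "block_orthonormal l E z"
    using z1(1) z2(1) by (simp add: block_orthonormal_def z_def)
  then obtain \<zeta> where \<zeta>: "block_orthonormal l (phi l) \<zeta>"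
    "gram_eq {..<l} (phi l) (\<lambda>k. lc {..<2 * l} (c k) \<zeta>) E (\<lambda>k. lc {..<2 * l} (c k) z)"
    using phi_vectors[of l E z c] False by blast
  have pad: "gram_eq {..<l} E (?pad v) N v" for v
    by (simp add: gram_eq_def ip_pad le)
  have zz: "lc {..<l} a z = lc {..<l} a z1" "lc {..<l} a (\<lambda>a. z (l + a)) = lc {..<l} a z2" for a
    by (auto simp: lc_def z_def)
  \<comment> \<open>The identity blocks keep each frame orthonormal, which preserves the Gram matrix
    of each summand separately; the condition on \<open>U\<close> takes care of the sums.\<close>
  have "gram_eq {..<l} (phi l) \<zeta> E z1" "gram_eq {..<l} (phi l) (\<lambda>a. \<zeta> (l + a)) E z2"
    using \<zeta>(1) z1(1) z2(1) by (simp_all add: gram_eq_def block_orthonormal_def)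
  then have "gram_eq {..<l} (phi l) (\<lambda>k. lc {..<l} (c1 k) \<zeta>) E (\<lambda>k. lc {..<l} (c1 k) z1)"
    "gram_eq {..<l} (phi l) (\<lambda>k. lc {..<l} (c2 k) (\<lambda>a. \<zeta> (l + a))) E (\<lambda>k. lc {..<l} (c2 k) z2)"
    by (simp_all only: gram_eq_lc)
  moreover have "gram_eq {..<l} E (\<lambda>k. lc {..<l} (c1 k) z1) N r"
    by (rule gram_eq_coord[OF pad]) (use z1(2) in simp)
  moreover have "gram_eq {..<l} E (\<lambda>k. lc {..<l} (c2 k) z2) N s"
    by (rule gram_eq_coord[OF pad]) (use z2(2) in simp)
  moreover have "gram_eq {..<l} E (\<lambda>k. lc {..<2 * l} (c k) z) N (\<lambda>k j. r k j + s k j)"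
    by (rule gram_eq_coord[OF pad]) (use z1(2) z2(2) in \<open>simp add: split zz\<close>)
  ultimately show ?thesis
    using that \<zeta>(2) unfolding split by (meson gram_eq_trans)
qed

section \<open>Realizing bags in low dimension\<close>

text \<open>By bilinearity, adding combinations of the \<open>x\<close> part with the same
  coefficients on both sides changes all inner products alike. This restores projections after work
  with residuals, adds the share of a bag to a partial sum, and subtracts a combination to test for
  equality.\<close>

lemma gram_eq_shear:
  assumes "gram_eq (I <+> K) D (case_sum x y) N (case_sum x' y')"
  shows "gram_eq (I <+> K) D (case_sum x (\<lambda>k j. y k j + lc I (q k) x j))
    N (case_sum x' (\<lambda>k j. y' k j + lc I (q k) x' j))"
proof -
  have xx: "ip D (x i) (x i') = ip N (x' i) (x' i')" if "i \<in> I" "i' \<in> I" for i i'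
    using gram_eqD[OF assms InlI[OF that(1)] InlI[OF that(2)]] by simp
  have xy: "ip D (x i) (y k) = ip N (x' i) (y' k)" if "i \<in> I" "k \<in> K" for i k
    using gram_eqD[OF assms InlI[OF that(1)] InrI[OF that(2)]] by simp
  have yx: "ip D (y k) (x i) = ip N (y' k) (x' i)" if "i \<in> I" "k \<in> K" for i k
    using xy[OF that] by (simp add: ip_commute)
  have yy: "ip D (y k) (y k') = ip N (y' k) (y' k')" if "k \<in> K" "k' \<in> K" for k k'
    using gram_eqD[OF assms InrI[OF that(1)] InrI[OF that(2)]] by simp
  show ?thesis
    unfolding gram_eq_def
    by (auto simp: ip_add_left ip_add_right ip_lc_left ip_lc_right xx xy yx yy intro!: sum.cong)
qed

text \<open>The new bag and the carried vectors are realized afresh, which the dimension permits,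
  and then moved by an isometry onto the vectors already placed.\<close>

lemma extend_node:
  assumes gram: "gram_eq ((B \<inter> S) <+> K) D (case_sum x1 y1) N (case_sum x y)"
    and fin: "finite B" "finite K" "card B + card K \<le> D"
  obtains x3 where "\<And>i. i \<in> S \<Longrightarrow> x3 i = x1 i"
    "gram_eq (B <+> K) D (case_sum x3 y1) N (case_sum x y)"
proof -
  obtain u where u: "gram_eq (B <+> K) D u N (case_sum x y)"
    by (rule gram_eq_realize[of "B <+> K" D N "case_sum x y"]) (use fin in \<open>simp_all add: card_Plus\<close>)
  have "gram_eq ((B \<inter> S) <+> K) D u N (case_sum x y)"
    by (rule gram_eq_mono[OF u]) auto
  then have "gram_eq ((B \<inter> S) <+> K) D (case_sum x1 y1) D u"
    by (rule gram_eq_trans[OF gram gram_eq_sym])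
  then obtain H where H: "lin_iso D H"
    "\<And>i k. i \<in> (B \<inter> S) <+> K \<Longrightarrow> k < D \<Longrightarrow> H (u i) k = case_sum x1 y1 i k"
    by (rule gram_eq_align[rotated]) (use fin in auto)
  \<comment> \<open>Placed vertices keep their vectors, including those outside \<open>B\<close>; on
    \<open>B \<inter> S\<close> the aligned vectors agree with them.\<close>
  define x3 where "x3 i = (if i \<in> S then x1 i else H (u (Inl i)))" for i
  have Hx: "H (u (Inl i)) k = x1 i k" if "i \<in> B" "i \<in> S" "k < D" for i k
    using H(2)[OF InlI that(3), of i] that by simp
  have Hy: "H (u (Inr c)) k = y1 c k" if "c \<in> K" "k < D" for c k
    using H(2)[OF InrI that(2), of c] that by simp
  have "gram_eq (B <+> K) D (case_sum x3 y1) N (case_sum x y)"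
    by (rule gram_eq_coord[OF gram_eq_lin_iso[OF H(1) u]])
       (auto simp: x3_def Hx Hy elim!: PlusE)
  then show ?thesis using that[of x3] by (simp add: x3_def)
qed

text \<open>The components of \<open>r\<close> and \<open>s\<close> in the span of the bag are
  copied by their coefficients. Only the residuals, orthogonal to the bag, have to be split by
  \<open>phi_join\<close>.\<close>

lemma split_node:
  fixes x :: "'v \<Rightarrow> nat \<Rightarrow> real"
  assumes gram: "gram_eq (I <+> {..<l}) (w + phi l) (case_sum x1 y1) N
      (case_sum x (\<lambda>k j. r k j + s k j))"
    and fin: "finite I" "card I \<le> w"
  obtains r1 s1 where "gram_eq (I <+> {..<l}) (w + phi l) (case_sum x1 r1) N (case_sum x r)"
    "gram_eq (I <+> {..<l}) (w + phi l) (case_sum x1 s1) N (case_sum x s)"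
    "\<And>k j. k < l \<Longrightarrow> j < w + phi l \<Longrightarrow> r1 k j + s1 k j = y1 k j"
proof -
  let ?D = "w + phi l"
  obtain x0 where x0: "gram_eq I w x0 N x"
    by (rule gram_eq_realize[OF fin])
  have "\<exists>a. \<forall>i\<in>I. ip N (\<lambda>j. v j - lc I a x j) (x i) = 0" for v
    by (rule projection_coeffs[OF fin(1), of N v x]) blast
  then obtain pr where pr: "\<And>v i. i \<in> I \<Longrightarrow> ip N (\<lambda>j. v j - lc I (pr v) x j) (x i) = 0"
    by metis
  define res where "res f k = (\<lambda>j. f k j - lc I (pr (f k)) x j)" for f :: "nat \<Rightarrow> nat \<Rightarrow> real" and k
  obtain \<rho> \<sigma> where rs: "gram_eq {..<l} (phi l) \<rho> N (res r)" "gram_eq {..<l} (phi l) \<sigma> N (res s)"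
    "gram_eq {..<l} (phi l) (\<lambda>k j. \<rho> k j + \<sigma> k j) N (\<lambda>k j. res r k j + res s k j)"
    by (rule phi_join)
  \<comment> \<open>The bag occupies the first \<open>w\<close> coordinates and the residuals the
    last \<open>phi l\<close>, so they are orthogonal by construction.\<close>
  define x2 where "x2 i j = (if j < w then x0 i j else 0)" for i j
  define up where "up v j = (if j < w then 0 else v (j - w))" for v :: "nat \<Rightarrow> real" and j :: nat
  have ip_up: "ip ?D (up u) (up v) = ip (phi l) u v" for u v
    by (simp add: ip_def sum_lessThan_add up_def)
  have ip_x2: "ip ?D (x2 i) (x2 i') = ip w (x0 i) (x0 i')" for i i'
    by (simp add: ip_def sum_lessThan_add x2_def)
  have ip_mix: "ip ?D (x2 i) (up v) = 0" for i v
    by (simp add: ip_def sum_lessThan_add x2_def up_def)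
  have orth: "gram_eq (I <+> {..<l}) ?D (case_sum x2 (\<lambda>k. up (\<tau> k))) N (case_sum x q)"
    if "gram_eq {..<l} (phi l) \<tau> N q" "\<And>k i. i \<in> I \<Longrightarrow> ip N (q k) (x i) = 0" for \<tau> q
    using that(1) that(2) x0 unfolding gram_eq_def
    by (auto simp: ip_up ip_x2 ip_mix ip_commute[of ?D "up _" "x2 _"] ip_commute[of N "x _" "q _"])
  define r2 where "r2 k j = up (\<rho> k) j + lc I (pr (r k)) x2 j" for k j
  define s2 where "s2 k j = up (\<sigma> k) j + lc I (pr (s k)) x2 j" for k j
  have res_orth: "ip N (res f k) (x i) = 0" if "i \<in> I" for f k i
    unfolding res_def using pr[OF that] .
  have gr: "gram_eq (I <+> {..<l}) ?D (case_sum x2 r2) N (case_sum x r)"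
    using gram_eq_shear[OF orth[OF rs(1) res_orth], where q = "\<lambda>k. pr (r k)"]
    by (simp add: r2_def[abs_def] res_def)
  have gs: "gram_eq (I <+> {..<l}) ?D (case_sum x2 s2) N (case_sum x s)"
    using gram_eq_shear[OF orth[OF rs(2) res_orth], where q = "\<lambda>k. pr (s k)"]
    by (simp add: s2_def[abs_def] res_def)
  have "gram_eq (I <+> {..<l}) ?D (case_sum x2 (\<lambda>k. up (\<lambda>j. \<rho> k j + \<sigma> k j)))
      N (case_sum x (\<lambda>k j. res r k j + res s k j))"
    by (rule orth[OF rs(3)]) (simp add: ip_add_left res_orth)
  \<comment> \<open>Adding both projections back turns the sum of the residuals into
    \<open>r + s\<close>.\<close>
  note shear = gram_eq_shear[OF this, where q = "\<lambda>k i. pr (r k) i + pr (s k) i"]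
  have e1: "(\<lambda>k j. up (\<lambda>j. \<rho> k j + \<sigma> k j) j + lc I (\<lambda>i. pr (r k) i + pr (s k) i) x2 j) =
      (\<lambda>k j. r2 k j + s2 k j)"
    by (auto simp: fun_eq_iff r2_def s2_def up_def lc_def distrib_right sum.distrib)
  have e2: "(\<lambda>k j. res r k j + res s k j + lc I (\<lambda>i. pr (r k) i + pr (s k) i) x j) =
      (\<lambda>k j. r k j + s k j)"
    by (auto simp: fun_eq_iff res_def lc_def distrib_right sum.distrib)
  have "gram_eq (I <+> {..<l}) ?D (case_sum x2 (\<lambda>k j. r2 k j + s2 k j))
      N (case_sum x (\<lambda>k j. r k j + s k j))"
    using shear unfolding e1 e2 .
  then have "gram_eq (I <+> {..<l}) ?D (case_sum x1 y1) ?D (case_sum x2 (\<lambda>k j. r2 k j + s2 k j))"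
    by (rule gram_eq_trans[OF gram gram_eq_sym])
  \<comment> \<open>The sums built here agree with \<open>y1\<close> only in inner products with the
    bag and with each other; the isometry makes them equal to \<open>y1\<close> in every coordinate
    while placing the bag at \<open>x1\<close>.\<close>
  then obtain H where H: "lin_iso ?D H"
    "\<And>i j. i \<in> I <+> {..<l} \<Longrightarrow> j < ?D \<Longrightarrow>
      H (case_sum x2 (\<lambda>k j. r2 k j + s2 k j) i) j = case_sum x1 y1 i j"
    by (rule gram_eq_align[rotated]) (use fin in auto)
  have Hx: "H (x2 i) j = x1 i j" if "i \<in> I" "j < ?D" for i j
    using H(2)[OF InlI[OF that(1)] that(2)] by simp
  have Hy: "H (\<lambda>j. r2 k j + s2 k j) j = y1 k j" if "k < l" "j < ?D" for k j
    using H(2)[OF InrI that(2), of k] that(1) by simp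
  show ?thesis
  proof (rule that[of "\<lambda>k. H (r2 k)" "\<lambda>k. H (s2 k)"])
    show "gram_eq (I <+> {..<l}) ?D (case_sum x1 (\<lambda>k. H (r2 k))) N (case_sum x r)"
      by (rule gram_eq_coord[OF gram_eq_lin_iso[OF H(1) gr]]) (auto simp: Hx elim!: PlusE)
    show "gram_eq (I <+> {..<l}) ?D (case_sum x1 (\<lambda>k. H (s2 k))) N (case_sum x s)"
      by (rule gram_eq_coord[OF gram_eq_lin_iso[OF H(1) gs]]) (auto simp: Hx elim!: PlusE)
    show "H (r2 k) j + H (s2 k) j = y1 k j" if "k < l" "j < ?D" for k j
      using Hy[OF that] by (simp add: lin_iso_add[OF H(1)])
  qed
qed

lemma gram_eq_Inl: "gram_eq (I <+> K) D u N v \<Longrightarrow> gram_eq I D (\<lambda>i. u (Inl i)) N (\<lambda>i. v (Inl i))"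
  and gram_eq_Inr: "gram_eq (I <+> K) D u N v \<Longrightarrow> gram_eq K D (\<lambda>k. u (Inr k)) N (\<lambda>k. v (Inr k))"
  unfolding gram_eq_def by (blast intro: InlI InrI)+

lemma sum_absorb_last:
  fixes f g :: "nat \<Rightarrow> real"
  assumes "s < m" "g s = f s + f m" "\<And>t. t < m \<Longrightarrow> t \<noteq> s \<Longrightarrow> g t = f t"
  shows "(\<Sum>t<Suc m. f t) = (\<Sum>t<m. g t)"
proof -
  have "(\<Sum>t<m. f t) = f s + (\<Sum>t\<in>{..<m} - {s}. f t)"
    using assms(1) by (intro sum.remove) auto
  moreover have "(\<Sum>t<m. g t) = g s + (\<Sum>t\<in>{..<m} - {s}. g t)"
    using assms(1) by (intro sum.remove) auto
  moreover have "(\<Sum>t\<in>{..<m} - {s}. g t) = (\<Sum>t\<in>{..<m} - {s}. f t)"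
    by (intro sum.cong) (auto intro: assms(3))
  ultimately show ?thesis using assms(2) by simp
qed

text \<open>
  The last node \<open>m\<close> is a leaf. Its vectors \<open>y m\<close> are first merged into those of its parent; after
  the smaller tree has been realized, the merged vectors are split again.
\<close>
lemma tree_realize:
  fixes V :: "nat \<Rightarrow> 'v set"
  assumes "\<And>t. t < m \<Longrightarrow> finite (V t) \<and> card (V t) \<le> w"
    and "\<And>t. 0 < t \<Longrightarrow> t < m \<Longrightarrow> par t < t"
    and "\<And>s t. s < t \<Longrightarrow> t < m \<Longrightarrow> V s \<inter> V t \<subseteq> V (par t)"
  shows "\<exists>x1 y1. (\<forall>t<m. gram_eq (V t <+> {..<l}) (w + phi l) (case_sum x1 (y1 t)) N (case_sum x (y t))) \<and>
    gram_eq {..<l} (w + phi l) (\<lambda>k j. \<Sum>t<m. y1 t k j) N (\<lambda>k j. \<Sum>t<m. y t k j)"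
  using assms
proof (induction m arbitrary: y)
  case 0
  show ?case by (simp add: gram_eq_def ip_def)
next
  case (Suc m)
  let ?D = "w + phi l"
  \<comment> \<open>Here \<open>l \<le> phi l\<close> enters: a single node has to fit together with
    its \<open>l\<close> vectors.\<close>
  have size: "finite (V m)" "card (V m) + card {..<l} \<le> ?D"
    using Suc.prems(1)[of m] le_phi[of l] by auto
  show ?case
  proof (cases "m = 0")
    case True
    obtain u where u: "gram_eq (V 0 <+> {..<l}) ?D u N (case_sum x (y 0))"
      by (rule gram_eq_realize[of "V 0 <+> {..<l}" ?D N "case_sum x (y 0)"])
         (use size True in \<open>simp_all add: card_Plus\<close>)
    have "gram_eq {..<l} ?D (\<lambda>k. u (Inr k)) N (y 0)"
      using gram_eq_Inr[OF u] by simp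
    moreover have "gram_eq (V 0 <+> {..<l}) ?D (case_sum (\<lambda>i. u (Inl i)) (\<lambda>k. u (Inr k)))
        N (case_sum x (y 0))"
      using u by (simp add: surjective_sum)
    ultimately show ?thesis
      using True by (intro exI[of _ "\<lambda>i. u (Inl i)"] exI[of _ "\<lambda>_ k. u (Inr k)"]) simp
  next
    case False
    define s where "s = par m"
    have s: "s < m" using Suc.prems(2)[of m] False by (simp add: s_def)
    define z where "z t k j = (if t = s then y s k j + y m k j else y t k j)" for t k j
    have "\<exists>x1 y1. (\<forall>t<m. gram_eq (V t <+> {..<l}) ?D (case_sum x1 (y1 t)) N (case_sum x (z t))) \<and>
      gram_eq {..<l} ?D (\<lambda>k j. \<Sum>t<m. y1 t k j) N (\<lambda>k j. \<Sum>t<m. z t k j)"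
      by (rule Suc.IH) (use Suc.prems in auto)
    then obtain x1 y1 where
      IH: "\<And>t. t < m \<Longrightarrow> gram_eq (V t <+> {..<l}) ?D (case_sum x1 (y1 t)) N (case_sum x (z t))"
      and tot: "gram_eq {..<l} ?D (\<lambda>k j. \<Sum>t<m. y1 t k j) N (\<lambda>k j. \<Sum>t<m. z t k j)"
      by blast
    have zs: "z s = (\<lambda>k j. y s k j + y m k j)" by (simp add: z_def fun_eq_iff)
    have zt: "z t = y t" if "t \<noteq> s" for t using that by (simp add: z_def fun_eq_iff)
    obtain r1 s1 where r1: "gram_eq (V s <+> {..<l}) ?D (case_sum x1 r1) N (case_sum x (y s))"
      and s1: "gram_eq (V s <+> {..<l}) ?D (case_sum x1 s1) N (case_sum x (y m))"
      and rs: "\<And>k j. k < l \<Longrightarrow> j < ?D \<Longrightarrow> r1 k j + s1 k j = y1 s k j"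
      using split_node[OF IH[OF s, unfolded zs]] Suc.prems(1)[of s] s by (metis less_Suc_eq)
    let ?S = "\<Union>t<m. V t"
    \<comment> \<open>The leaf shares with all earlier bags only vertices of its parent, and for
      these \<open>s1\<close> already has the right inner products.\<close>
    have "(V m \<inter> ?S) <+> {..<l} \<subseteq> V s <+> {..<l}"
      using Suc.prems(3)[of _ m] by (auto simp: s_def)
    then have "gram_eq ((V m \<inter> ?S) <+> {..<l}) ?D (case_sum x1 s1) N (case_sum x (y m))"
      by (rule gram_eq_mono[OF s1])
    then obtain x3 where x3: "\<And>i. i \<in> ?S \<Longrightarrow> x3 i = x1 i"
      "gram_eq (V m <+> {..<l}) ?D (case_sum x3 s1) N (case_sum x (y m))"
      using extend_node[of "V m" ?S "{..<l}" ?D x1 s1 N x "y m"] size by auto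
    have agree: "case_sum x3 v i j = case_sum x1 v i j" if "t < m" "i \<in> V t <+> {..<l}"
      for t i j and v :: "nat \<Rightarrow> nat \<Rightarrow> real"
    proof -
      have "x3 c = x1 c" if "c \<in> V t" for c
        by (rule x3(1)) (use that \<open>t < m\<close> in blast)
      then show ?thesis using that(2) by (auto elim!: PlusE)
    qed
    define y3 where "y3 t = (if t = m then s1 else if t = s then r1 else y1 t)" for t
    have bag: "gram_eq (V t <+> {..<l}) ?D (case_sum x3 (y3 t)) N (case_sum x (y t))" if "t < Suc m" for t
    proof (cases "t = m")
      case True
      then show ?thesis using x3(2) by (simp add: y3_def)
    next
      case False
      then have t: "t < m" using that by simp
      have "gram_eq (V t <+> {..<l}) ?D (case_sum x1 (y3 t)) N (case_sum x (y t))"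
        using r1 IH[OF t] zt[of t] t by (auto simp: y3_def)
      then show ?thesis
        by (rule gram_eq_coord) (rule agree[OF t])
    qed
    have total: "(\<Sum>t<Suc m. y t k j) = (\<Sum>t<m. z t k j)" for k j
      by (rule sum_absorb_last[OF s]) (simp_all add: z_def)
    \<comment> \<open>The total is unchanged coordinatewise; this is why the split has to reproduce
      \<open>y1 s\<close> exactly and not just its Gram matrix.\<close>
    have "(\<Sum>t<Suc m. y3 t k j) = (\<Sum>t<m. y1 t k j)" if "k \<in> {..<l}" "j < ?D" for k j
      by (rule sum_absorb_last[OF s]) (use s rs that in \<open>auto simp: y3_def\<close>)
    then have "gram_eq {..<l} ?D (\<lambda>k j. \<Sum>t<Suc m. y3 t k j) N (\<lambda>k j. \<Sum>t<Suc m. y t k j)"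
      unfolding total by (rule gram_eq_coord[OF tot])
    with bag show ?thesis by blast
  qed
qed

text \<open>Linear relations are visible in the Gram matrix: the difference of the two sides is
  matched with the zero vector, so its norm vanishes. The abstract vectors of
  \<open>tree_realize\<close> thereby become combinations of realized vertices again.\<close>

lemma gram_eq_lc_eq:
  assumes "gram_eq (I <+> K) D (case_sum x1 y1) N (case_sum x (\<lambda>k. lc I (q k) x))"
    and "k \<in> K" "j < D"
  shows "y1 k j = lc I (q k) x1 j"
proof -
  define d where "d = (\<lambda>j. y1 k j + lc I (\<lambda>i. - q k i) x1 j)"
  have neg: "lc I (\<lambda>i. - q k i) v = (\<lambda>j. - lc I (q k) v j)" for v k
    by (simp add: lc_def sum_negf)
  have "ip D d d = ip N (\<lambda>j. 0) (\<lambda>j. 0)"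
    using gram_eqD[OF gram_eq_shear[OF assms(1), where q = "\<lambda>k i. - q k i"] InrI[OF assms(2)] InrI[OF assms(2)]]
    by (simp add: neg d_def)
  then have "d j = 0"
    using assms(3) by (intro ip_self_zeroD[of D d j]) (simp_all add: ip_def)
  then show ?thesis by (simp add: d_def neg)
qed

text \<open>The vectors attached to the nodes in \<open>tree_realize\<close> are arbitrary; here
  they are the contributions of the bags to the global sums.\<close>

lemma tree_gram:
  fixes V :: "nat \<Rightarrow> 'v set"
  assumes fin: "\<And>t. t < m \<Longrightarrow> finite (V t) \<and> card (V t) \<le> w"
    and par: "\<And>t. 0 < t \<Longrightarrow> t < m \<Longrightarrow> par t < t"
    and int: "\<And>s t. s < t \<Longrightarrow> t < m \<Longrightarrow> V s \<inter> V t \<subseteq> V (par t)"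
  obtains x1 where "\<And>t. t < m \<Longrightarrow> gram_eq (V t) (w + phi l) x1 N x"
    "gram_eq {..<l} (w + phi l) (\<lambda>k. lc (\<Union>t<m. V t) (p k) x1) N (\<lambda>k. lc (\<Union>t<m. V t) (p k) x)"
proof -
  let ?D = "w + phi l" and ?S = "\<Union>t<m. V t"
  have "\<exists>t<m. i \<in> V t" if "i \<in> ?S" for i using that by auto
  then obtain \<tau> where \<tau>: "\<And>i. i \<in> ?S \<Longrightarrow> \<tau> i < m \<and> i \<in> V (\<tau> i)" by metis
  have finS: "finite ?S" using fin by auto
  \<comment> \<open>Each vertex is charged to one chosen bag \<open>\<tau> i\<close>, since it would
    otherwise be counted once per bag containing it.\<close>
  define q where "q t k i = (if \<tau> i = t then p k i else 0)" for t k i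
  have collect: "(\<Sum>t<m. lc (V t) (q t k) v j) = lc ?S (p k) v j" for k j and v :: "'v \<Rightarrow> nat \<Rightarrow> real"
  proof -
    have "lc (V t) (q t k) v j = (\<Sum>i\<in>{i \<in> ?S. \<tau> i = t}. p k i * v i j)" if "t < m" for t
      unfolding lc_def
      by (rule sum.mono_neutral_cong_right) (use fin \<tau> that in \<open>auto simp: q_def\<close>)
    then have "(\<Sum>t<m. lc (V t) (q t k) v j) = (\<Sum>t<m. \<Sum>i\<in>{i \<in> ?S. \<tau> i = t}. p k i * v i j)"
      by (intro sum.cong) auto
    also have "\<dots> = (\<Sum>i\<in>?S. p k i * v i j)"
      by (rule sum.group) (use finS \<tau> in auto)
    finally show ?thesis by (simp add: lc_def)
  qed
  have "\<exists>x1 y1. (\<forall>t<m. gram_eq (V t <+> {..<l}) ?D (case_sum x1 (y1 t))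
        N (case_sum x (\<lambda>k. lc (V t) (q t k) x))) \<and>
      gram_eq {..<l} ?D (\<lambda>k j. \<Sum>t<m. y1 t k j) N (\<lambda>k j. \<Sum>t<m. lc (V t) (q t k) x j)"
    by (rule tree_realize[where m = m and V = V and w = w and par = par]) (fact fin par int)+
  then obtain x1 y1 where
    g: "\<forall>t<m. gram_eq (V t <+> {..<l}) ?D (case_sum x1 (y1 t)) N (case_sum x (\<lambda>k. lc (V t) (q t k) x))"
    and tot: "gram_eq {..<l} ?D (\<lambda>k j. \<Sum>t<m. y1 t k j) N (\<lambda>k. lc ?S (p k) x)"
    unfolding collect by (elim exE conjE)
  note g = g[rule_format]
  show ?thesis
  proof (rule that[of x1])
    show "gram_eq (V t) ?D x1 N x" if "t < m" for t
      using gram_eq_Inl[OF g[OF that]] by simp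
    show "gram_eq {..<l} ?D (\<lambda>k. lc ?S (p k) x1) N (\<lambda>k. lc ?S (p k) x)"
    proof (rule gram_eq_coord[OF tot])
      fix k j assume kj: "k \<in> {..<l}" "j < ?D"
      have "y1 t k j = lc (V t) (q t k) x1 j" if "t < m" for t
        by (rule gram_eq_lc_eq[OF g[OF that] kj])
      then show "lc ?S (p k) x1 j = (\<Sum>t<m. y1 t k j)"
        unfolding collect[symmetric] by (intro sum.cong) auto
    qed
  qed
qed

text \<open>The invariant includes the inner products of the partial sums with the last bag: this is
  what lets the next bag be attached with the sums held fixed. The sums then change only within the
  span of the new bag, so nothing has to be split.\<close>

lemma path_realize:
  fixes V :: "nat \<Rightarrow> 'v set"
  assumes "\<And>t. t \<le> m \<Longrightarrow> finite (V t) \<and> card (V t) \<le> w"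
    and "\<And>s t. s \<le> t \<Longrightarrow> t < m \<Longrightarrow> V s \<inter> V (Suc t) \<subseteq> V t"
  shows "\<exists>x1. (\<forall>t\<le>m. gram_eq (V t) (w + l) x1 N x) \<and>
    gram_eq (V m <+> {..<l}) (w + l) (case_sum x1 (\<lambda>k. lc (\<Union>t\<le>m. V t) (p k) x1))
      N (case_sum x (\<lambda>k. lc (\<Union>t\<le>m. V t) (p k) x))"
  using assms
proof (induction m)
  case 0
  obtain u where u: "gram_eq (V 0) (w + l) u N x"
    using gram_eq_realize[of "V 0" "w + l" N x] 0(1)[of 0] by auto
  \<comment> \<open>The sweep starts with empty sums; the shear by \<open>p\<close> adds the first
    bag.\<close>
  have "gram_eq (V 0 <+> {..<l}) (w + l) (case_sum u (\<lambda>k j. 0)) N (case_sum x (\<lambda>k j. 0))"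
    using u unfolding gram_eq_def by (auto simp: ip_def)
  note shear = gram_eq_shear[OF this, where q = p]
  have "(\<Union>t\<le>0. V t) = V 0" by simp
  with shear u show ?case
    by (intro exI[of _ u]) simp
next
  case (Suc m)
  let ?D = "w + l" and ?S = "\<Union>t\<le>m. V t" and ?B = "V (Suc m)"
  have "\<exists>x1. (\<forall>t\<le>m. gram_eq (V t) ?D x1 N x) \<and>
    gram_eq (V m <+> {..<l}) ?D (case_sum x1 (\<lambda>k. lc ?S (p k) x1)) N (case_sum x (\<lambda>k. lc ?S (p k) x))"
    by (rule Suc.IH) (use Suc.prems in auto)
  then obtain x1 where IH: "\<And>t. t \<le> m \<Longrightarrow> gram_eq (V t) ?D x1 N x"
    "gram_eq (V m <+> {..<l}) ?D (case_sum x1 (\<lambda>k. lc ?S (p k) x1)) N (case_sum x (\<lambda>k. lc ?S (p k) x))"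
    by blast
  have fin: "finite ?B" "card ?B + card {..<l} \<le> ?D"
    using Suc.prems(1)[of "Suc m"] by auto
  have "(?B \<inter> ?S) <+> {..<l} \<subseteq> V m <+> {..<l}"
    using Suc.prems(2)[of _ m] by auto
  then have "gram_eq ((?B \<inter> ?S) <+> {..<l}) ?D (case_sum x1 (\<lambda>k. lc ?S (p k) x1))
      N (case_sum x (\<lambda>k. lc ?S (p k) x))"
    by (rule gram_eq_mono[OF IH(2)])
  then obtain x3 where x3: "\<And>i. i \<in> ?S \<Longrightarrow> x3 i = x1 i"
    "gram_eq (?B <+> {..<l}) ?D (case_sum x3 (\<lambda>k. lc ?S (p k) x1)) N (case_sum x (\<lambda>k. lc ?S (p k) x))"
    using extend_node[of ?B ?S "{..<l}" ?D x1 "\<lambda>k. lc ?S (p k) x1" N x "\<lambda>k. lc ?S (p k) x"] fin by auto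
  \<comment> \<open>Vertices of earlier bags are already in the partial sums; only new ones
    contribute.\<close>
  define q where "q k i = (if i \<in> ?S then 0 else p k i)" for k i
  have finS: "finite ?S" using Suc.prems(1) by auto
  have union: "(\<Union>t\<le>Suc m. V t) = ?S \<union> (?B - ?S)"
    by (auto simp: le_Suc_eq)
  have add: "(\<lambda>j. lc ?S (p k) v j + lc ?B (q k) v j) = lc (\<Union>t\<le>Suc m. V t) (p k) v"
    for k and v :: "'v \<Rightarrow> nat \<Rightarrow> real"
  proof
    fix j
    have "lc ?B (q k) v j = (\<Sum>i\<in>?B - ?S. p k i * v i j)"
      unfolding lc_def by (rule sum.mono_neutral_cong_right) (use fin in \<open>auto simp: q_def\<close>)
    then show "lc ?S (p k) v j + lc ?B (q k) v j = lc (\<Union>t\<le>Suc m. V t) (p k) v j"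
      unfolding union lc_def using finS fin by (subst sum.union_disjoint) auto
  qed
  have "lc ?S (p k) x1 = lc ?S (p k) x3" for k
    unfolding lc_def by (intro ext sum.cong) (auto simp: x3(1))
  then have "gram_eq (?B <+> {..<l}) ?D (case_sum x3 (\<lambda>k. lc ?S (p k) x3)) N (case_sum x (\<lambda>k. lc ?S (p k) x))"
    using x3(2) by simp
  from gram_eq_shear[OF this, where q = q]
  have last: "gram_eq (?B <+> {..<l}) ?D (case_sum x3 (\<lambda>k. lc (\<Union>t\<le>Suc m. V t) (p k) x3))
      N (case_sum x (\<lambda>k. lc (\<Union>t\<le>Suc m. V t) (p k) x))"
    unfolding add .
  have bag: "gram_eq (V t) ?D x3 N x" if "t \<le> Suc m" for t
  proof (cases "t = Suc m")
    case True
    then show ?thesis using gram_eq_Inl[OF last] by simp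
  next
    case False
    then have t: "t \<le> m" using that by simp
    show ?thesis
    proof (rule gram_eq_coord[OF IH(1)[OF t]])
      fix i j assume "i \<in> V t"
      then have "x3 i = x1 i" by (intro x3(1)) (use t in blast)
      then show "x3 i j = x1 i j" by simp
    qed
  qed
  show ?case using last bag by blast
qed

lemma path_gram:
  fixes V :: "nat \<Rightarrow> 'v set"
  assumes fin: "\<And>t. t < m \<Longrightarrow> finite (V t) \<and> card (V t) \<le> w"
    and int: "\<And>s t. s \<le> t \<Longrightarrow> Suc t < m \<Longrightarrow> V s \<inter> V (Suc t) \<subseteq> V t"
  obtains x1 where "\<And>t. t < m \<Longrightarrow> gram_eq (V t) (w + l) x1 N x"
    "gram_eq {..<l} (w + l) (\<lambda>k. lc (\<Union>t<m. V t) (p k) x1) N (\<lambda>k. lc (\<Union>t<m. V t) (p k) x)"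
proof (cases m)
  case 0
  then show ?thesis using that[of x] by (simp add: gram_eq_def lc_def ip_def)
next
  case (Suc m')
  obtain x1 where x1: "\<And>t. t \<le> m' \<Longrightarrow> gram_eq (V t) (w + l) x1 N x"
    "gram_eq (V m' <+> {..<l}) (w + l) (case_sum x1 (\<lambda>k. lc (\<Union>t\<le>m'. V t) (p k) x1))
      N (case_sum x (\<lambda>k. lc (\<Union>t\<le>m'. V t) (p k) x))"
    using path_realize[of m' V w l N x p] assms Suc by auto
  have "{..<m} = {..m'}" using Suc by auto
  then show ?thesis
    using that[of x1] x1(1) gram_eq_Inr[OF x1(2)] Suc by simp
qed

section \<open>Orderings of tree decompositions\<close>

lemma reachable_crossing:
  assumes "u \<rightarrow>\<^sup>*\<^bsub>G\<^esub> v" "u \<in> S" "v \<notin> S"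
  obtains p q where "(p, q) \<in> arcs_ends G" "p \<in> S" "q \<notin> S"
proof -
  have "v \<in> S \<or> (\<exists>p q. (p, q) \<in> arcs_ends G \<and> p \<in> S \<and> q \<notin> S)"
    using assms(1)[unfolded reachable_def]
    by (induction rule: rtrancl_on_induct) (use assms(2) in blast)+
  then show ?thesis using assms(3) that by blast
qed

text \<open>Connectivity as needed for growing an ordering: as long as vertices are missing, some
  arc leads to a new one.\<close>

lemma undirected_tree_crossing:
  assumes T: "undirected_tree T" and S: "S \<subseteq> pverts T" "S \<noteq> {}" "S \<noteq> pverts T"
  obtains p q where "(p, q) \<in> parcs T" "(q, p) \<in> parcs T" "p \<in> S" "q \<in> pverts T - S"
proof -
  interpret pair_graph T using T by (simp add: undirected_tree_def)
  \<comment> \<open>\<open>connected\<close> refers to the symmetric closure, which has the same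
    arcs as the symmetric graph \<open>T\<close>.\<close>
  have sym: "parcs (mk_symmetric (with_proj T)) = parcs T"
    using adj_mk_symmetric_eq[OF pair_sym_arcs] by simp
  obtain a b where ab: "a \<in> S" "b \<in> pverts T" "b \<notin> S"
    using S by blast
  then have "a \<rightarrow>\<^sup>*\<^bsub>with_proj (mk_symmetric (with_proj T))\<^esub> b"
    using T S(1) unfolding undirected_tree_def connected_def strongly_connected_def by auto
  then obtain p q where pq: "(p, q) \<in> parcs T" "p \<in> S" "q \<notin> S"
    using ab(1,3) by (rule reachable_crossing) (auto simp: sym)
  then have "(q, p) \<in> parcs T" by (simp add: arcs_symmetric)
  with pq show ?thesis by (intro that[of p q]) (auto intro: in_arcsD2)
qed

lemma vpath_snoc:
  assumes "vpath q (with_proj T)" "(last q, v) \<in> parcs T" "v \<in> pverts T" "v \<notin> set q"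
  shows "vpath (q @ [v]) (with_proj T)"
  using assms by (auto simp: vpath_def vwalk_def set_vwalk_arcs_snoc)

lemma vpath_cons:
  assumes "vpath q (with_proj T)" "(v, hd q) \<in> parcs T" "v \<in> pverts T" "v \<notin> set q"
  shows "vpath (v # q) (with_proj T)"
  using assms by (cases q) (auto simp: vpath_def vwalk_def)

text \<open>
  Adding the vertices one at a time along an arc from the part already built, the parent of a new
  vertex lies on a path from any earlier vertex.
\<close>
lemma attach_ordering:
  assumes T: "undirected_tree T" and k: "0 < k" "k \<le> card (pverts T)"
  shows "\<exists>ts. length ts = k \<and> distinct ts \<and> set ts \<subseteq> pverts T \<and>
    (\<forall>a\<in>set ts. \<forall>b\<in>set ts. \<exists>q. vpath q (with_proj T) \<and> set q \<subseteq> set ts \<and> hd q = a \<and> last q = b) \<and>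
    (\<forall>j<k. 0 < j \<longrightarrow> (\<exists>p<j. \<forall>i<j. \<exists>q. vpath q (with_proj T) \<and>
       hd q = ts ! i \<and> last q = ts ! j \<and> ts ! p \<in> set q))"
  using k
proof (induction k rule: nat_induct_non_zero)
  case 1
  then obtain r where r: "r \<in> pverts T" by (metis card.empty ex_in_conv not_one_le_zero)
  then have "vpath [r] (with_proj T)" by (simp add: vpath_def vwalk_def)
  with r show ?case by (intro exI[of _ "[r]"]) auto
next
  case (Suc k)
  interpret pair_graph T using T by (simp add: undirected_tree_def)
  obtain ts where len: "length ts = k" and dist: "distinct ts" and sub: "set ts \<subseteq> pverts T"
    and conn: "\<And>a b. a \<in> set ts \<Longrightarrow> b \<in> set ts \<Longrightarrow>
      \<exists>q. vpath q (with_proj T) \<and> set q \<subseteq> set ts \<and> hd q = a \<and> last q = b"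
    and par: "\<And>j. j < k \<Longrightarrow> 0 < j \<Longrightarrow> \<exists>p<j. \<forall>i<j. \<exists>q. vpath q (with_proj T) \<and>
       hd q = ts ! i \<and> last q = ts ! j \<and> ts ! p \<in> set q"
    using Suc.IH Suc.prems by auto
  have "card (set ts) = k" using len dist distinct_card by blast
  then have "set ts \<noteq> pverts T" "set ts \<noteq> {}" using Suc by auto
  then obtain p v where pv: "(p, v) \<in> parcs T" "(v, p) \<in> parcs T" "p \<in> set ts" "v \<in> pverts T" "v \<notin> set ts"
    using undirected_tree_crossing[OF T sub] by blast
  \<comment> \<open>Paths are kept inside the part already built, so that appending the new vertex
    \<open>v\<close> repeats no vertex; they pass through \<open>p\<close> just before reaching
    \<open>v\<close>.\<close>
  have to_v: "\<exists>q. vpath q (with_proj T) \<and> set q \<subseteq> insert v (set ts) \<and> hd q = a \<and> last q = v \<and> p \<in> set q"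
    if a: "a \<in> set ts" for a
  proof -
    obtain q where q: "vpath q (with_proj T)" "set q \<subseteq> set ts" "hd q = a" "last q = p"
      using conn[OF a pv(3)] by blast
    have "q \<noteq> []" using q(1) by (auto simp: vpath_def vwalk_def)
    then have "p \<in> set q" using q(4) last_in_set by blast
    moreover have "vpath (q @ [v]) (with_proj T)"
      by (rule vpath_snoc[OF q(1)]) (use q pv in auto)
    ultimately show ?thesis
      using q \<open>q \<noteq> []\<close> by (intro exI[of _ "q @ [v]"]) auto
  qed
  have from_v: "\<exists>q. vpath q (with_proj T) \<and> set q \<subseteq> insert v (set ts) \<and> hd q = v \<and> last q = b"
    if b: "b \<in> set ts" for b
  proof -
    obtain q where q: "vpath q (with_proj T)" "set q \<subseteq> set ts" "hd q = p" "last q = b"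
      using conn[OF pv(3) b] by blast
    have "q \<noteq> []" using q(1) by (auto simp: vpath_def vwalk_def)
    moreover have "vpath (v # q) (with_proj T)"
      by (rule vpath_cons[OF q(1)]) (use q pv in auto)
    ultimately show ?thesis
      using q by (intro exI[of _ "v # q"]) auto
  qed
  have "vpath [v] (with_proj T)" using pv(4) by (simp add: vpath_def vwalk_def)
  then have "\<exists>q. vpath q (with_proj T) \<and> set q \<subseteq> set (ts @ [v]) \<and> hd q = a \<and> last q = b"
    if ab: "a \<in> set (ts @ [v])" "b \<in> set (ts @ [v])" for a b
  proof -
    consider "a = v" "b = v" | "a \<in> set ts" "b \<in> set ts" | "a = v" "b \<in> set ts" | "a \<in> set ts" "b = v"
      using ab by auto
    then show ?thesis
    proof cases
      case 1
      then show ?thesis using \<open>vpath [v] (with_proj T)\<close> by (intro exI[of _ "[v]"]) simp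
    next
      case 2
      then obtain q where "vpath q (with_proj T)" "set q \<subseteq> set ts" "hd q = a" "last q = b"
        using conn by blast
      then show ?thesis by (intro exI[of _ q]) auto
    next
      case 3
      then show ?thesis using from_v by simp
    next
      case 4
      then show ?thesis using to_v[of a] by auto
    qed
  qed
  moreover have "\<exists>p<j. \<forall>i<j. \<exists>q. vpath q (with_proj T) \<and>
       hd q = (ts @ [v]) ! i \<and> last q = (ts @ [v]) ! j \<and> (ts @ [v]) ! p \<in> set q"
    if j: "j < Suc k" "0 < j" for j
  proof (cases "j = k")
    case True
    obtain c where c: "c < k" "ts ! c = p" using pv(3) len by (metis in_set_conv_nth)
    have "\<exists>q. vpath q (with_proj T) \<and> hd q = ts ! i \<and> last q = v \<and> p \<in> set q" if "i < k" for i
      using to_v[of "ts ! i"] that len by auto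
    then show ?thesis
      using True c len by (intro exI[of _ c]) (auto simp: nth_append)
  next
    case False
    then have jk: "j < k" using j by simp
    from par[OF this j(2)] obtain c where c: "c < j" "\<forall>i<j. \<exists>q. vpath q (with_proj T) \<and>
       hd q = ts ! i \<and> last q = ts ! j \<and> ts ! c \<in> set q" by blast
    then show ?thesis
      using jk len by (intro exI[of _ c]) (auto simp: nth_append)
  qed
  ultimately show ?case
    using len dist sub pv by (intro exI[of _ "ts @ [v]"]) simp
qed

lemma tree_decompositionD:
  assumes "tree_decomposition G T V"
  shows "t \<in> pverts T \<Longrightarrow> V t \<subseteq> pverts G" "pverts G = (\<Union>t\<in>pverts T. V t)"
    "(i, j) \<in> parcs G \<Longrightarrow> \<exists>t\<in>pverts T. i \<in> V t \<and> j \<in> V t"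
  using assms unfolding tree_decomposition_def by blast+

lemma tree_decomposition_inter:
  assumes "tree_decomposition G T V" "vpath q (with_proj T)" "t \<in> set q"
  shows "V (hd q) \<inter> V (last q) \<subseteq> V t"
  using assms by (simp add: tree_decomposition_def)

lemma tree_decomposition_nodes:
  assumes "tree_decomposition G T V"
  shows "finite (pverts T)" "pverts T \<noteq> {}"
proof -
  have T: "undirected_tree T" using assms by (simp add: tree_decomposition_def)
  then interpret pair_graph T by (simp add: undirected_tree_def)
  show "finite (pverts T)" by (rule pair_finite_verts)
  show "pverts T \<noteq> {}"
    using T by (auto simp: undirected_tree_def connected_def strongly_connected_def)
qed

text \<open>Condition (c) along the paths through the parent becomes a statement about indices,
  which is the form needed for removing the last node as a leaf.\<close>

lemma tree_decomposition_ordering: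
  assumes dec: "tree_decomposition G T V"
  obtains ts par where "set ts = pverts T" "\<And>t. 0 < t \<Longrightarrow> t < length ts \<Longrightarrow> par t < t"
    "\<And>s t. s < t \<Longrightarrow> t < length ts \<Longrightarrow> V (ts ! s) \<inter> V (ts ! t) \<subseteq> V (ts ! par t)"
proof -
  have T: "undirected_tree T" using dec by (simp add: tree_decomposition_def)
  have pos: "0 < card (pverts T)"
    using tree_decomposition_nodes[OF dec] by (simp add: card_gt_0_iff)
  obtain ts where ts: "length ts = card (pverts T)" "distinct ts" "set ts \<subseteq> pverts T"
    and par: "\<forall>j<card (pverts T). 0 < j \<longrightarrow> (\<exists>p<j. \<forall>i<j. \<exists>q. vpath q (with_proj T) \<and>
       hd q = ts ! i \<and> last q = ts ! j \<and> ts ! p \<in> set q)"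
    using attach_ordering[OF T pos order_refl] by (elim exE conjE)
  have "set ts = pverts T"
    using ts tree_decomposition_nodes(1)[OF dec] by (simp add: card_subset_eq distinct_card)
  moreover have "\<forall>j. \<exists>p. j < length ts \<and> 0 < j \<longrightarrow> p < j \<and> (\<forall>i<j. V (ts ! i) \<inter> V (ts ! j) \<subseteq> V (ts ! p))"
  proof
    fix j
    show "\<exists>p. j < length ts \<and> 0 < j \<longrightarrow> p < j \<and> (\<forall>i<j. V (ts ! i) \<inter> V (ts ! j) \<subseteq> V (ts ! p))"
    proof (cases "j < length ts \<and> 0 < j")
      case True
      then obtain p where p: "p < j" "\<forall>i<j. \<exists>q. vpath q (with_proj T) \<and>
         hd q = ts ! i \<and> last q = ts ! j \<and> ts ! p \<in> set q"
        using par ts(1) by auto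
      have "V (ts ! i) \<inter> V (ts ! j) \<subseteq> V (ts ! p)" if "i < j" for i
        using p(2)[rule_format, OF that] tree_decomposition_inter[OF dec] by metis
      with p(1) show ?thesis by blast
    qed blast
  qed
  then obtain par where "\<forall>j. j < length ts \<and> 0 < j \<longrightarrow> par j < j \<and> (\<forall>i<j. V (ts ! i) \<inter> V (ts ! j) \<subseteq> V (ts ! par j))"
    by (rule choice[THEN exE])
  ultimately show ?thesis
    by (intro that[of ts par]) auto
qed

lemma vpath_sublist:
  assumes "vpath p G" "i \<le> t" "Suc t < length p"
  obtains q where "vpath q G" "hd q = p ! i" "last q = p ! Suc t" "p ! t \<in> set q"
proof -
  \<comment> \<open>The segment includes both positions \<open>i\<close> and
    \<open>Suc t\<close>.\<close>
  define q where "q = drop i (take (Suc (Suc t)) p)"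
  have p: "p = take i p @ q @ drop (Suc (Suc t)) p"
    using assms(2,3) unfolding q_def by (metis append.assoc append_take_drop_id le_SucI min_absorb1 take_take)
  have len: "length q = Suc (Suc t) - i" using assms by (simp add: q_def)
  have nth: "q ! c = p ! (i + c)" if "c < length q" for c
    using that assms by (simp add: q_def)
  have "q \<noteq> []" using len assms(2) by auto
  have sub: "set (vwalk_arcs q) \<subseteq> set (vwalk_arcs (xs @ q @ ys))" for xs ys
    using set_vwalk_arcs_append1[of q ys] set_vwalk_arcs_append2[of "q @ ys" xs] by blast
  have "vpath q G"
    using assms(1) sub[of "take i p" "drop (Suc (Suc t)) p", folded p] \<open>q \<noteq> []\<close>
    unfolding vpath_def vwalk_def q_def
    by (auto dest!: in_set_dropD in_set_takeD)
  moreover have "hd q = p ! i" using nth[of 0] \<open>q \<noteq> []\<close> by (simp add: hd_conv_nth)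
  moreover have "last q = p ! Suc t"
    using nth[of "length q - 1"] \<open>q \<noteq> []\<close> len assms(2) by (simp add: last_conv_nth)
  moreover have "p ! t \<in> set q"
    using nth[of "t - i"] len assms(2) by (metis Suc_diff_le Suc_leI le_add_diff_inverse lessI less_Suc_eq_le nth_mem le_SucI)
  ultimately show ?thesis by (rule that)
qed

lemma path_decomposition_ordering:
  assumes dec: "tree_decomposition G T V" and path: "path_graph T"
  obtains ts where "set ts = pverts T"
    "\<And>s t. s \<le> t \<Longrightarrow> Suc t < length ts \<Longrightarrow> V (ts ! s) \<inter> V (ts ! Suc t) \<subseteq> V (ts ! t)"
proof -
  obtain p where p: "p \<noteq> []" "distinct p" "pverts T = set p" "set (vwalk_arcs p) \<subseteq> parcs T"
    using path unfolding path_graph_def by blast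
  then have vp: "vpath p (with_proj T)" by (simp add: vpath_def vwalk_def)
  show ?thesis
  proof (rule that[of p])
    fix s t assume st: "s \<le> t" "Suc t < length p"
    obtain q where "vpath q (with_proj T)" "hd q = p ! s" "last q = p ! Suc t" "p ! t \<in> set q"
      by (rule vpath_sublist[OF vp st])
    then show "V (p ! s) \<inter> V (p ! Suc t) \<subseteq> V (p ! t)"
      using tree_decomposition_inter[OF dec] by metis
  qed (simp add: p)
qed

section \<open>Existence of decompositions of minimum width\<close>

lemma trivial_decomposition:
  assumes "pair_graph G"
  shows "tree_decomposition G \<lparr>pverts = {0 :: nat}, parcs = {}\<rparr> (\<lambda>_. pverts G)"
    "path_graph \<lparr>pverts = {0 :: nat}, parcs = {}\<rparr>"
proof -
  let ?T = "\<lparr>pverts = {0 :: nat}, parcs = {}\<rparr>"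
  interpret pair_graph G by fact
  have "pair_graph ?T"
    by unfold_locales (auto simp: symmetric_def sym_def)
  moreover have "connected (with_proj ?T)"
    by (auto simp: connected_def strongly_connected_def reachable_def intro: rtrancl_on_refl)
  moreover have "length p \<le> 1" if "vpath p (with_proj ?T)" for p
  proof -
    have "card (set p) \<le> card {0 :: nat}"
      using that by (intro card_mono) (auto simp: vpath_def vwalk_def)
    then show ?thesis using that by (simp add: vpath_def distinct_card)
  qed
  ultimately have "undirected_tree ?T"
    unfolding undirected_tree_def by (metis numeral_le_one_iff order_trans semiring_norm(70))
  then show "tree_decomposition G ?T (\<lambda>_. pverts G)"
    by (auto simp: tree_decomposition_def vpath_def vwalk_def dest: in_arcsD1 in_arcsD2)
  show "path_graph ?T"
    unfolding path_graph_def by (intro exI[of _ "[0]"]) simp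
qed

lemma decomposition_bag:
  assumes "tree_decomposition G T V" "t \<in> pverts T"
  shows "int (card (V t)) \<le> decomposition_width T V + 1"
  using tree_decomposition_nodes(1)[OF assms(1)] assms(2) by (simp add: decomposition_width_def)

text \<open>Bounded integer widths form a finite set, so together with the one-bag decomposition
  each \<open>Min\<close> is attained. The lower bound also makes the width plus 1 a natural
  number.\<close>

lemma decomposition_width_range:
  assumes G: "pair_graph G" and dec: "tree_decomposition G T V"
  shows "decomposition_width T V \<in> {-1..int (card (pverts G))}"
proof -
  interpret pair_graph G by fact
  have "card (V t) \<le> card (pverts G)" if "t \<in> pverts T" for t
    using that dec by (intro card_mono pair_finite_verts) (auto simp: tree_decomposition_def)
  then have "Max ((\<lambda>t. card (V t)) ` pverts T) \<le> card (pverts G)"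
    using tree_decomposition_nodes[OF dec] by simp
  then show ?thesis by (simp add: decomposition_width_def)
qed

lemma treewidth_attained:
  assumes "pair_graph G"
  obtains T :: "nat pair_pre_digraph" and V
  where "tree_decomposition G T V" "decomposition_width T V = treewidth G"
proof -
  let ?W = "{decomposition_width T V | (T :: nat pair_pre_digraph) V. tree_decomposition G T V}"
  have "finite ?W"
    by (rule finite_subset[of ?W "{-1..int (card (pverts G))}"])
      (blast intro: decomposition_width_range[OF assms], simp)
  moreover have "?W \<noteq> {}" using trivial_decomposition(1)[OF assms] by blast
  ultimately have "treewidth G \<in> ?W" unfolding treewidth_def by (rule Min_in)
  then show ?thesis using that by auto
qed

lemma pathwidth_attained:
  assumes "pair_graph G"
  obtains T :: "nat pair_pre_digraph" and V
  where "tree_decomposition G T V" "path_graph T" "decomposition_width T V = pathwidth G"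
proof -
  let ?W = "{decomposition_width T V | (T :: nat pair_pre_digraph) V. tree_decomposition G T V \<and> path_graph T}"
  have "finite ?W"
    by (rule finite_subset[of ?W "{-1..int (card (pverts G))}"])
      (blast intro: decomposition_width_range[OF assms], simp)
  moreover have "?W \<noteq> {}" using trivial_decomposition[OF assms] by blast
  ultimately have "pathwidth G \<in> ?W" unfolding pathwidth_def by (rule Min_in)
  then show ?thesis using that by auto
qed

section \<open>Reduction of the semidefinite program\<close>

lemma trace_inner_eq_sum:
  assumes "A \<in> carrier_mat n n" "X \<in> carrier_mat n n"
  shows "trace_inner A X = (\<Sum>r<n. \<Sum>c<n. A $$ (r, c) * X $$ (r, c))"
proof -
  have "trace_inner A X = (\<Sum>c<n. \<Sum>r<n. A $$ (r, c) * X $$ (r, c))"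
    using assms by (simp add: trace_inner_def mat_trace_def scalar_prod_def atLeast0LessThan)
  also have "\<dots> = (\<Sum>r<n. \<Sum>c<n. A $$ (r, c) * X $$ (r, c))"
    by (rule sum.swap)
  finally show ?thesis .
qed

text \<open>
  The coefficients \<open>a\<close> are those of the orthogonal projection onto the span of the vectors \<open>u c\<close>,
  which therefore fixes the rows and columns of \<open>L\<close>.
\<close>
lemma symmetric_factor:
  fixes u :: "'c \<Rightarrow> nat \<Rightarrow> real" and a :: "nat \<Rightarrow> 'c \<Rightarrow> real" and L :: "nat \<Rightarrow> nat \<Rightarrow> real"
  assumes proj: "\<And>r c. r < n \<Longrightarrow> c \<in> C \<Longrightarrow> u c r = (\<Sum>d\<in>C. a r d * ip n (u d) (u c))"
    and span: "\<And>r j. r < n \<Longrightarrow> j < n \<Longrightarrow> L r j = (\<Sum>c\<in>C. \<alpha> j c * u c r)"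
    and sym: "\<And>r j. r < n \<Longrightarrow> j < n \<Longrightarrow> L r j = L j r"
    and rj: "r < n" "j < n"
  shows "L r j = (\<Sum>d\<in>C. a r d * (\<Sum>e\<in>C. a j e * (\<Sum>s<n. u d s * (\<Sum>t<n. u e t * L t s))))"
proof -
  have fix_L: "L r j = (\<Sum>d\<in>C. a r d * (\<Sum>s<n. u d s * L s j))" if "r < n" "j < n" for r j
  proof -
    have "L r j = (\<Sum>c\<in>C. \<Sum>d\<in>C. a r d * (\<alpha> j c * ip n (u d) (u c)))"
      using span[OF that] proj[OF that(1)] by (simp add: sum_distrib_left mult_ac)
    also have "\<dots> = (\<Sum>d\<in>C. \<Sum>c\<in>C. a r d * (\<alpha> j c * ip n (u d) (u c)))"
      by (rule sum.swap)
    also have "\<dots> = (\<Sum>d\<in>C. a r d * ip n (u d) (lc C (\<alpha> j) u))"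
      by (simp add: ip_lc_right sum_distrib_left)
    also have "\<dots> = (\<Sum>d\<in>C. a r d * (\<Sum>s<n. u d s * L s j))"
    proof -
      have "ip n (u d) (lc C (\<alpha> j) u) = (\<Sum>s<n. u d s * L s j)" for d
        unfolding ip_def lc_def by (intro sum.cong) (use span that(2) in auto)
      then show ?thesis by simp
    qed
    finally show ?thesis .
  qed
  have "(\<Sum>s<n. u d s * L s j) = (\<Sum>e\<in>C. a j e * (\<Sum>s<n. u d s * (\<Sum>t<n. u e t * L t s)))" for d
  proof -
    have "(\<Sum>s<n. u d s * L s j) = (\<Sum>s<n. u d s * (\<Sum>e\<in>C. a j e * (\<Sum>t<n. u e t * L t s)))"
    proof (rule sum.cong[OF refl])
      fix s assume "s \<in> {..<n}"
      then have "L s j = (\<Sum>e\<in>C. a j e * (\<Sum>t<n. u e t * L t s))"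
        using sym[of s j] fix_L[of j s] rj(2) by simp
      then show "u d s * L s j = u d s * (\<Sum>e\<in>C. a j e * (\<Sum>t<n. u e t * L t s))"
        by simp
    qed
    also have "\<dots> = (\<Sum>s<n. \<Sum>e\<in>C. a j e * (u d s * (\<Sum>t<n. u e t * L t s)))"
      by (simp only: sum_distrib_left mult.left_commute[of "u d _" "a j _"])
    also have "\<dots> = (\<Sum>e\<in>C. \<Sum>s<n. a j e * (u d s * (\<Sum>t<n. u e t * L t s)))"
      by (rule sum.swap)
    finally show ?thesis by (simp only: sum_distrib_left)
  qed
  then show ?thesis using fix_L[OF rj] by simp
qed

text \<open>The columns of all low-rank parts lie in one space of dimension at most
  \<open>l\<close>. Since \<open>A i\<close> and \<open>S i\<close> are symmetric, so is their
  difference; projecting both its rows and its columns onto that space gives \<open>a B a^T\<close>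
  with the same \<open>a\<close> for all \<open>i\<close>.\<close>

lemma SPLR_factor:
  assumes splr: "SPLR n m G l A" and A: "\<And>i. i \<le> m \<Longrightarrow> A i \<in> sym_mats n"
  obtains a S B where "\<And>i. i \<le> m \<Longrightarrow> S i \<in> sparse_sym_mats n G"
    "\<And>i r c. i \<le> m \<Longrightarrow> r < n \<Longrightarrow> c < n \<Longrightarrow>
       A i $$ (r, c) = S i $$ (r, c) + (\<Sum>k<l. \<Sum>k'<l. a k r * (a k' c * B i k k'))"
proof -
  obtain S L where SL: "\<And>i. i \<le> m \<Longrightarrow> S i \<in> sparse_sym_mats n G \<and> L i \<in> carrier_mat n n \<and> A i = S i + L i"
    and rank: "vec_space.rank n (concat_mats n m L) \<le> l"
    using splr unfolding SPLR_def by blast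
  let ?M = "concat_mats n m L"
  have M: "?M \<in> carrier_mat n ((m + 1) * n)" by (simp add: concat_mats_def)
  obtain C where C: "C \<subseteq> {..<(m + 1) * n}" "card C = vec_space.rank n ?M"
    "\<And>j. j < (m + 1) * n \<Longrightarrow> \<exists>\<alpha>. \<forall>i<n. ?M $$ (i, j) = (\<Sum>c\<in>C. \<alpha> c * ?M $$ (i, c))"
    by (rule column_basis[OF M]) blast
  have finC: "finite C" using C(1) finite_subset by blast
  define u where "u c r = ?M $$ (r, c)" for c r
  \<comment> \<open>Projecting the unit vector at \<open>r\<close> yields row \<open>r\<close> of
    the projection, because its inner product with \<open>u c\<close> is
    \<open>u c r\<close>.\<close>
  have "\<exists>\<alpha>. \<forall>c\<in>C. ip n (\<lambda>k. unit_fun r k - lc C \<alpha> u k) (u c) = 0" for r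
    by (rule projection_coeffs[OF finC, of n "unit_fun r" u]) blast
  then obtain pr where pr: "\<And>r c. c \<in> C \<Longrightarrow> ip n (\<lambda>k. unit_fun r k - lc C (pr r) u k) (u c) = 0"
    by metis
  have proj: "u c r = (\<Sum>d\<in>C. pr r d * ip n (u d) (u c))" if "r < n" "c \<in> C" for r c
    using pr[OF that(2), of r] that(1) by (simp add: ip_diff_left ip_unit_fun_left ip_lc_left)
  obtain h where h: "bij_betw h {..<card C} C"
    using ex_bij_betw_nat_finite[OF finC] by (auto simp: atLeast0LessThan)
  \<comment> \<open>The rank may be smaller than \<open>l\<close>; the missing coefficient vectors
    are zero.\<close>
  define a where "a k r = (if k < card C then pr r (h k) else 0)" for k r
  have reindex: "(\<Sum>d\<in>C. pr r d * f d) = (\<Sum>k<l. a k r * f (h k))" for r f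
  proof -
    have "(\<Sum>d\<in>C. pr r d * f d) = (\<Sum>k<card C. pr r (h k) * f (h k))"
      by (rule sum.reindex_bij_betw[OF h, symmetric])
    also have "\<dots> = (\<Sum>k<l. a k r * f (h k))"
      by (rule sum.mono_neutral_cong_left) (use rank C(2) in \<open>auto simp: a_def\<close>)
    finally show ?thesis .
  qed
  define B where "B i k k' = (\<Sum>s<n. u (h k) s * (\<Sum>t<n. u (h k') t * L i $$ (t, s)))" for i k k'
  show ?thesis
  proof (rule that[of S a B])
    show "S i \<in> sparse_sym_mats n G" if "i \<le> m" for i using SL[OF that] by blast
    fix i r c assume i: "i \<le> m" and rc: "r < n" "c < n"
    have Si: "S i \<in> carrier_mat n n" "transpose_mat (S i) = S i"
      using SL[OF i] by (auto simp: sparse_sym_mats_def sym_mats_def)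
    have Ai: "A i \<in> carrier_mat n n" "transpose_mat (A i) = A i"
      using A[OF i] by (auto simp: sym_mats_def)
    have Li: "L i \<in> carrier_mat n n" "A i = S i + L i" using SL[OF i] by auto
    have symm: "X $$ (p, q) = X $$ (q, p)"
      if "X \<in> carrier_mat n n" "transpose_mat X = X" "p < n" "q < n" for X :: "real mat" and p q
      using that by (metis carrier_matD index_transpose_mat(1))
    have ad: "A i $$ (p, q) = S i $$ (p, q) + L i $$ (p, q)" if "p < n" "q < n" for p q
      unfolding Li(2) using that Si Li(1) by simp
    have Lsym: "L i $$ (p, q) = L i $$ (q, p)" if "p < n" "q < n" for p q
      using ad[OF that] ad[OF that(2,1)] symm[OF Si that] symm[OF Ai that] by simp
    \<comment> \<open>Column \<open>q\<close> of block \<open>i\<close> of the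
      concatenation.\<close>
    have col: "u (i * n + q) p = L i $$ (p, q)" if "p < n" "q < n" for p q
    proof -
      have "i * n + q < (m + 1) * n"
      proof -
        have "i * n \<le> m * n" "(m + 1) * n = m * n + n" using i by simp_all
        then show ?thesis using that(2) by linarith
      qed
      then show ?thesis using that by (simp add: u_def concat_mats_def)
    qed
    have "\<exists>\<alpha>. \<forall>p<n. L i $$ (p, q) = (\<Sum>c\<in>C. \<alpha> c * u c p)" if "q < n" for q
    proof -
      have "i * n \<le> m * n" "(m + 1) * n = m * n + n" using i by simp_all
      then have "i * n + q < (m + 1) * n" using that by linarith
      from C(3)[OF this] show ?thesis
        using col[OF _ that] by (simp add: u_def)
    qed
    then obtain \<alpha> where \<alpha>: "\<And>p q. p < n \<Longrightarrow> q < n \<Longrightarrow> L i $$ (p, q) = (\<Sum>c\<in>C. \<alpha> q c * u c p)"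
      by metis
    have "L i $$ (r, c) = (\<Sum>d\<in>C. pr r d * (\<Sum>e\<in>C. pr c e * (\<Sum>s<n. u d s * (\<Sum>t<n. u e t * L i $$ (t, s)))))"
      by (rule symmetric_factor[where L = "\<lambda>p q. L i $$ (p, q)" and \<alpha> = \<alpha>, OF proj \<alpha> Lsym rc])
    then have "L i $$ (r, c) = (\<Sum>k<l. a k r * (\<Sum>k'<l. a k' c * B i k k'))"
      by (simp only: reindex B_def)
    then show "A i $$ (r, c) = S i $$ (r, c) + (\<Sum>k<l. \<Sum>k'<l. a k r * (a k' c * B i k k'))"
      using ad[OF rc] by (simp only: sum_distrib_left)
  qed
qed

text \<open>The contribution of \<open>a B a^T\<close> to a trace depends on the vectors only
  through the Gram matrix of the \<open>l\<close> combined vectors.\<close>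

lemma sum_lc_lc:
  "(\<Sum>r<n. \<Sum>c<n. (\<Sum>k<l. \<Sum>k'<l. a k r * (a k' c * B k k')) * ip D (x r) (x c)) =
   (\<Sum>k<l. \<Sum>k'<l. B k k' * ip D (lc {..<n} (a k) x) (lc {..<n} (a k') x))"
proof -
  let ?g = "\<lambda>r c k k'. B k k' * (a k r * (a k' c * ip D (x r) (x c)))"
  have "(\<Sum>r<n. \<Sum>c<n. (\<Sum>k<l. \<Sum>k'<l. a k r * (a k' c * B k k')) * ip D (x r) (x c)) =
      (\<Sum>r<n. \<Sum>c<n. \<Sum>k<l. \<Sum>k'<l. ?g r c k k')"
    by (simp add: sum_distrib_left sum_distrib_right mult_ac)
  also have "\<dots> = (\<Sum>r<n. \<Sum>k<l. \<Sum>c<n. \<Sum>k'<l. ?g r c k k')"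
    by (intro sum.cong refl sum.swap)
  also have "\<dots> = (\<Sum>k<l. \<Sum>r<n. \<Sum>c<n. \<Sum>k'<l. ?g r c k k')"
    by (rule sum.swap)
  also have "\<dots> = (\<Sum>k<l. \<Sum>r<n. \<Sum>k'<l. \<Sum>c<n. ?g r c k k')"
    by (intro sum.cong refl sum.swap)
  also have "\<dots> = (\<Sum>k<l. \<Sum>k'<l. \<Sum>r<n. \<Sum>c<n. ?g r c k k')"
    by (intro sum.cong refl sum.swap)
  also have "\<dots> = (\<Sum>k<l. \<Sum>k'<l. B k k' * ip D (lc {..<n} (a k) x) (lc {..<n} (a k') x))"
    unfolding ip_lc_left unfolding ip_lc_right by (simp only: sum_distrib_left)
  finally show ?thesis .
qed

lemma trace_inner_preserved:
  assumes A: "A \<in> carrier_mat n n" and S: "S \<in> sparse_sym_mats n G"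
    and dec: "\<And>r c. r < n \<Longrightarrow> c < n \<Longrightarrow>
       A $$ (r, c) = S $$ (r, c) + (\<Sum>k<l. \<Sum>k'<l. a k r * (a k' c * B k k'))"
    and sparse: "\<And>r c. r < n \<Longrightarrow> c < n \<Longrightarrow> r = c \<or> (r, c) \<in> parcs G \<Longrightarrow>
       ip D (x1 r) (x1 c) = ip N (x r) (x c)"
    and low: "gram_eq {..<l} D (\<lambda>k. lc {..<n} (a k) x1) N (\<lambda>k. lc {..<n} (a k) x)"
  shows "trace_inner A (gram_mat n D x1) = trace_inner A (gram_mat n N x)"
proof -
  have eq: "trace_inner A (gram_mat n E y) = (\<Sum>r<n. \<Sum>c<n. S $$ (r, c) * ip E (y r) (y c)) +
      (\<Sum>k<l. \<Sum>k'<l. B k k' * ip E (lc {..<n} (a k) y) (lc {..<n} (a k') y))" for E y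
    using dec by (simp add: trace_inner_eq_sum[OF A gram_mat_carrier] gram_mat_index distrib_right
        sum.distrib sum_lc_lc)
  have "S $$ (r, c) * ip D (x1 r) (x1 c) = S $$ (r, c) * ip N (x r) (x c)" if "r < n" "c < n" for r c
  proof (cases "r = c \<or> (r, c) \<in> parcs G")
    case True
    then show ?thesis using sparse[OF that] by simp
  next
    case False
    then have "S $$ (r, c) = 0" using S that by (auto simp: sparse_sym_mats_def)
    then show ?thesis by simp
  qed
  then have "(\<Sum>r<n. \<Sum>c<n. S $$ (r, c) * ip D (x1 r) (x1 c)) = (\<Sum>r<n. \<Sum>c<n. S $$ (r, c) * ip N (x r) (x c))"
    by (intro sum.cong refl) simp
  moreover have "(\<Sum>k<l. \<Sum>k'<l. B k k' * ip D (lc {..<n} (a k) x1) (lc {..<n} (a k') x1)) =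
      (\<Sum>k<l. \<Sum>k'<l. B k k' * ip N (lc {..<n} (a k) x) (lc {..<n} (a k') x))"
    using gram_eqD[OF low] by (intro sum.cong refl) simp
  ultimately show ?thesis by (simp only: eq)
qed

text \<open>Tree and path enter only through \<open>realize\<close>, used with the coefficients of
  the low-rank factor. All constraint values and the objective are preserved exactly, so the new
  Gram matrix is again optimal.\<close>

lemma sdp_optimal_low_rank:
  assumes A: "\<And>i. i \<le> m \<Longrightarrow> A i \<in> sym_mats n" and splr: "SPLR n m G l A"
    and opt: "sdp_optimal n m A bl bu \<noteq> {}"
    and bags: "\<And>i. i < n \<Longrightarrow> \<exists>t<q. i \<in> V t" "\<And>i j. (i, j) \<in> parcs G \<Longrightarrow> \<exists>t<q. i \<in> V t \<and> j \<in> V t"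
    and realize: "\<And>x p. \<exists>x1. (\<forall>t<q. gram_eq (V t) D x1 n x) \<and>
      gram_eq {..<l} D (\<lambda>k. lc {..<n} (p k) x1) n (\<lambda>k. lc {..<n} (p k) x)"
  shows "\<exists>X \<in> sdp_optimal n m A bl bu. vec_space.rank n X \<le> D"
proof -
  obtain X where X: "X \<in> sdp_optimal n m A bl bu" using opt by blast
  then have psd: "X \<in> psd_mats n" by (simp add: sdp_optimal_def sdp_feasible_def)
  then have car: "X \<in> carrier_mat n n" by (simp add: psd_mats_def sym_mats_def)
  have "vec_space.rank n X \<le> n" by (rule vec_space.rank_le_nc[OF car])
  then obtain x where x: "\<And>i j. i < n \<Longrightarrow> j < n \<Longrightarrow> ip n (x i) (x j) = X $$ (i, j)"
    using psd_mats_realize[OF psd] by blast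
  have X_gram: "X = gram_mat n n x"
    by (rule eq_matI) (use car x in \<open>auto simp: gram_mat_def\<close>)
  obtain a S B where S: "\<And>i. i \<le> m \<Longrightarrow> S i \<in> sparse_sym_mats n G"
    and dec: "\<And>i r c. i \<le> m \<Longrightarrow> r < n \<Longrightarrow> c < n \<Longrightarrow>
       A i $$ (r, c) = S i $$ (r, c) + (\<Sum>k<l. \<Sum>k'<l. a k r * (a k' c * B i k k'))"
    by (rule SPLR_factor[OF splr A]) (assumption, rule that, assumption+)
  obtain x1 where x1: "\<forall>t<q. gram_eq (V t) D x1 n x"
    "gram_eq {..<l} D (\<lambda>k. lc {..<n} (a k) x1) n (\<lambda>k. lc {..<n} (a k) x)"
    using realize[of x a] by (elim exE conjE)
  \<comment> \<open>Diagonal entries belong to the sparse pattern although the graph has no loops;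
    for them it matters that every single vertex lies in some bag.\<close>
  have sparse: "ip D (x1 r) (x1 c) = ip n (x r) (x c)"
    if rc: "r < n" "c < n" "r = c \<or> (r, c) \<in> parcs G" for r c
  proof -
    obtain t where t: "t < q" "r \<in> V t" "c \<in> V t" using rc bags by blast
    from x1(1)[rule_format, OF t(1)] t(2,3) show ?thesis by (rule gram_eqD)
  qed
  have same: "trace_inner (A i) (gram_mat n D x1) = trace_inner (A i) X" if "i \<le> m" for i
  proof -
    have "A i \<in> carrier_mat n n" using A[OF that] by (simp add: sym_mats_def)
    then show ?thesis
      unfolding X_gram by (rule trace_inner_preserved[OF _ S[OF that] dec[OF that] sparse x1(2)])
  qed
  have "gram_mat n D x1 \<in> sdp_optimal n m A bl bu"
    using X gram_mat_psd same by (simp add: sdp_optimal_def sdp_feasible_def)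
  then show ?thesis using rank_gram_mat by blast
qed

theorem theorem1p6:
  fixes n m l :: nat
    and G :: "nat pair_pre_digraph"
    and A :: "nat \<Rightarrow> real mat"
    and bl bu :: "nat \<Rightarrow> ereal"
  assumes "pair_graph G" and "pverts G = {0..<n}"
    and "\<And>i. i \<le> m \<Longrightarrow> A i \<in> sym_mats n"
    and "\<And>i. i \<in> {1..m} \<Longrightarrow> - \<infinity> \<le> bl i \<and> bl i \<le> bu i \<and> bu i < \<infinity>"
    and "SPLR n m G l A"
  shows "(sdp_optimal n m A bl bu \<noteq> {} \<longrightarrow>
           (\<exists>X \<in> sdp_optimal n m A bl bu.
              int (vec_space.rank n X) \<le> treewidth G + int (phi l) + 1))
       \<and> (treewidth G = pathwidth G \<and> sdp_optimal n m A bl bu \<noteq> {} \<longrightarrow>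
           (\<exists>X \<in> sdp_optimal n m A bl bu.
              int (vec_space.rank n X) \<le> treewidth G + int l + 1))"
proof (intro conjI impI)
  have bags: "finite (V (ts ! t))" "int (card (V (ts ! t))) \<le> decomposition_width T V + 1"
    if "tree_decomposition G T V" "set ts = pverts T" "t < length ts" for T V and ts :: "nat list" and t
  proof -
    have t: "ts ! t \<in> pverts T" using nth_mem[OF that(3)] that(2) by simp
    have "V (ts ! t) \<subseteq> {0..<n}"
      using tree_decompositionD(1)[OF that(1) t] assms(2) by simp
    then show "finite (V (ts ! t))" by (rule finite_subset) simp
    show "int (card (V (ts ! t))) \<le> decomposition_width T V + 1"
      by (rule decomposition_bag[OF that(1) t])
  qed
  have union: "(\<Union>t<length ts. V (ts ! t)) = {..<n}"
    if "tree_decomposition G T V" "set ts = pverts T" for T V and ts :: "nat list"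
  proof -
    have "(\<Union>t<length ts. V (ts ! t)) = (\<Union>t\<in>set ts. V t)" by (auto simp: set_conv_nth)
    also have "\<dots> = {..<n}"
      using tree_decompositionD(2)[OF that(1)] that(2) assms(2) by (simp add: atLeast0LessThan)
    finally show ?thesis .
  qed
  have edge: "\<exists>t<length ts. i \<in> V (ts ! t) \<and> j \<in> V (ts ! t)"
    if e: "tree_decomposition G T V" "set ts = pverts T" "(i, j) \<in> parcs G" for T V i j and ts :: "nat list"
  proof -
    obtain t where "t \<in> set ts" "i \<in> V t" "j \<in> V t"
      using tree_decompositionD(3)[OF e(1,3)] e(2) by blast
    then show ?thesis by (auto simp: in_set_conv_nth)
  qed
  {
    assume opt: "sdp_optimal n m A bl bu \<noteq> {}"
    obtain T :: "nat pair_pre_digraph" and V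
      where T: "tree_decomposition G T V" "decomposition_width T V = treewidth G"
      by (rule treewidth_attained[OF assms(1)])
    obtain ts par where ts: "set ts = pverts T" and par: "\<And>t. 0 < t \<Longrightarrow> t < length ts \<Longrightarrow> par t < t"
      and inter: "\<And>s t. s < t \<Longrightarrow> t < length ts \<Longrightarrow> V (ts ! s) \<inter> V (ts ! t) \<subseteq> V (ts ! par t)"
      by (rule tree_decomposition_ordering[OF T(1)]) blast
    \<comment> \<open>The size of the largest bag; since widths are at least -1, \<open>nat\<close>
      truncates nothing.\<close>
    define w where "w = nat (treewidth G + 1)"
    have "0 \<le> treewidth G + 1"
      using decomposition_width_range[OF assms(1) T(1)] T(2) by simp
    then have w: "int w = treewidth G + 1" by (simp add: w_def)
    have fin: "finite (V (ts ! t)) \<and> card (V (ts ! t)) \<le> w" if "t < length ts" for t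
      using bags[OF T(1) ts that] T(2) w by simp
    have "\<exists>X \<in> sdp_optimal n m A bl bu. vec_space.rank n X \<le> w + phi l"
    proof (rule sdp_optimal_low_rank[OF assms(3,5) opt, where V = "\<lambda>t. V (ts ! t)" and q = "length ts"])
      show "\<exists>t<length ts. i \<in> V (ts ! t)" if "i < n" for i
        using union[OF T(1) ts] that by blast
      show "\<exists>t<length ts. i \<in> V (ts ! t) \<and> j \<in> V (ts ! t)" if "(i, j) \<in> parcs G" for i j
        by (rule edge[OF T(1) ts that])
      show "\<exists>x1. (\<forall>t<length ts. gram_eq (V (ts ! t)) (w + phi l) x1 n x) \<and>
          gram_eq {..<l} (w + phi l) (\<lambda>k. lc {..<n} (p k) x1) n (\<lambda>k. lc {..<n} (p k) x)" for x p
      proof (rule tree_gram[where V = "\<lambda>t. V (ts ! t)" and m = "length ts" and w = w and par = par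
            and l = l and N = n and x = x and p = p, unfolded union[OF T(1) ts]])
        show "finite (V (ts ! t)) \<and> card (V (ts ! t)) \<le> w" if "t < length ts" for t
          by (rule fin[OF that])
        show "par t < t" if "0 < t" "t < length ts" for t by (rule par[OF that])
        show "V (ts ! s) \<inter> V (ts ! t) \<subseteq> V (ts ! par t)" if "s < t" "t < length ts" for s t
          by (rule inter[OF that])
        fix x1
        assume "\<And>t. t < length ts \<Longrightarrow> gram_eq (V (ts ! t)) (w + phi l) x1 n x"
          "gram_eq {..<l} (w + phi l) (\<lambda>k. lc {..<n} (p k) x1) n (\<lambda>k. lc {..<n} (p k) x)"
        then show "\<exists>x1. (\<forall>t<length ts. gram_eq (V (ts ! t)) (w + phi l) x1 n x) \<and>
            gram_eq {..<l} (w + phi l) (\<lambda>k. lc {..<n} (p k) x1) n (\<lambda>k. lc {..<n} (p k) x)"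
          by (intro exI[of _ x1] conjI allI impI)
      qed
    qed
    then show "\<exists>X \<in> sdp_optimal n m A bl bu. int (vec_space.rank n X) \<le> treewidth G + int (phi l) + 1"
      using w by force
  }
  {
    assume "treewidth G = pathwidth G \<and> sdp_optimal n m A bl bu \<noteq> {}"
    then have tw: "treewidth G = pathwidth G" and opt: "sdp_optimal n m A bl bu \<noteq> {}" by simp_all
    \<comment> \<open>A path decomposition of minimum width; the assumed equality of widths makes
      its bags as small as those of an optimal tree decomposition.\<close>
    obtain T :: "nat pair_pre_digraph" and V
      where T: "tree_decomposition G T V" "path_graph T" "decomposition_width T V = pathwidth G"
      by (rule pathwidth_attained[OF assms(1)])
    obtain ts where ts: "set ts = pverts T"
      and inter: "\<And>s t. s \<le> t \<Longrightarrow> Suc t < length ts \<Longrightarrow> V (ts ! s) \<inter> V (ts ! Suc t) \<subseteq> V (ts ! t)"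
      by (rule path_decomposition_ordering[OF T(1,2)]) blast
    define w where "w = nat (treewidth G + 1)"
    have "0 \<le> treewidth G + 1"
      using decomposition_width_range[OF assms(1) T(1)] T(3) tw by simp
    then have w: "int w = treewidth G + 1" by (simp add: w_def)
    have fin: "finite (V (ts ! t)) \<and> card (V (ts ! t)) \<le> w" if "t < length ts" for t
      using bags[OF T(1) ts that] T(3) tw w by simp
    have "\<exists>X \<in> sdp_optimal n m A bl bu. vec_space.rank n X \<le> w + l"
    proof (rule sdp_optimal_low_rank[OF assms(3,5) opt, where V = "\<lambda>t. V (ts ! t)" and q = "length ts"])
      show "\<exists>t<length ts. i \<in> V (ts ! t)" if "i < n" for i
        using union[OF T(1) ts] that by blast
      show "\<exists>t<length ts. i \<in> V (ts ! t) \<and> j \<in> V (ts ! t)" if "(i, j) \<in> parcs G" for i j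
        by (rule edge[OF T(1) ts that])
      show "\<exists>x1. (\<forall>t<length ts. gram_eq (V (ts ! t)) (w + l) x1 n x) \<and>
          gram_eq {..<l} (w + l) (\<lambda>k. lc {..<n} (p k) x1) n (\<lambda>k. lc {..<n} (p k) x)" for x p
      proof (rule path_gram[where V = "\<lambda>t. V (ts ! t)" and m = "length ts" and w = w
            and l = l and N = n and x = x and p = p, unfolded union[OF T(1) ts]])
        show "finite (V (ts ! t)) \<and> card (V (ts ! t)) \<le> w" if "t < length ts" for t
          by (rule fin[OF that])
        show "V (ts ! s) \<inter> V (ts ! Suc t) \<subseteq> V (ts ! t)" if "s \<le> t" "Suc t < length ts" for s t
          by (rule inter[OF that])
        fix x1
        assume "\<And>t. t < length ts \<Longrightarrow> gram_eq (V (ts ! t)) (w + l) x1 n x"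
          "gram_eq {..<l} (w + l) (\<lambda>k. lc {..<n} (p k) x1) n (\<lambda>k. lc {..<n} (p k) x)"
        then show "\<exists>x1. (\<forall>t<length ts. gram_eq (V (ts ! t)) (w + l) x1 n x) \<and>
            gram_eq {..<l} (w + l) (\<lambda>k. lc {..<n} (p k) x1) n (\<lambda>k. lc {..<n} (p k) x)"
          by (intro exI[of _ x1] conjI allI impI)
      qed
    qed
    then show "\<exists>X \<in> sdp_optimal n m A bl bu. int (vec_space.rank n X) \<le> treewidth G + int l + 1"
      using w by force
  }
qed

end
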